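(* Let $\lambda$ be a frequency and $k\ge0$. Let $m:\mathbb N\to\mathbb N$ be a function such that $m(n)>n$ and $\lambda_{m(n)}-\lambda_n\le2$ for all $n\in\mathbb N$, and put $\tilde m(n)=\sup\{j\in\mathbb N: m(j)\le n\}$. There exists $C>0$ such that, for all $n\in\mathbb N$ for which $\{j\in\mathbb N:m(j)\le n\}$ is non-empty, $$\sup_{\lambda_n\le x\le\lambda_{n+1}}\left\|R^{\lambda,k}_x\right\|_{\mathcal L(\mathcal D^{\mathrm{ext}}_{\infty,k}(\lambda))}\le C\sum_{l=\tilde m(n)}^{n}\left(\log\left(\frac{\lambda_{m(l)}}{\lambda_{m(l)}-\lambda_l}\right)+\sum_{j=l+1}^{m(l)-1}\left(\frac{\lambda_j-\lambda_l}{\varepsilon_j}\right)^k\right).$$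
   Context: $\mathbb N=\{1,2,\dots\}$ and $\mathbb C_\theta=\{s\in\mathbb C:\operatorname{Re}s>\theta\}$. A frequency is a strictly increasing sequence $\lambda=(\lambda_n)_{n\in\mathbb N}$ of non-negative reals tending to infinity. Put $\varepsilon_1=\min\{1,\lambda_2-\lambda_1\}$ and $\varepsilon_n=\min\{1,\lambda_n-\lambda_{n-1},\lambda_{n+1}-\lambda_n\}$ for $n\ge2$. Empty sums are $0$. $\mathcal D(\lambda)$ is the space of all formal $\lambda$-Dirichlet series $D=\sum_{n=1}^\infty a_n(D)e^{-\lambda_n s}$ with $a_n(D)\in\mathbb C$. For real $l\ge0$, $x>0$ and $s\in\mathbb C$ let $$R^{\lambda,l}_x(D)(s)=\sum_{\lambda_n\le x}a_n(D)\left(1-\frac{\lambda_n}{x}\right)^l e^{-\lambda_n s}$$ (with $0^0=1$). $D$ is $(\lambda,l)$-summable at $s$ if $\lim_{x\to\infty}R^{\lambda,l}_x(D)(s)$ exists. Put $\sigma^{\lambda,l}(D)=\inf\{\sigma\in\mathbb R: D\text{ is }(\lambda,l)\text{-summable at }\sigma\}$ (infimum in $[-\infty,\infty]$). It is known that $(\lambda,l)$-summability at $s_0$ implies $(\lambda,l)$-summability on $\mathbb C_{\operatorname{Re}s_0}$ with holomorphic limit function, and that $(\lambda,l)$-summability implies $(\lambda,l')$-summability to the same limit for $l'\ge l$. For $k\ge0$, $\mathcal D^{\mathrm{ext}}_{\infty,k}(\lambda)$ is the space of all $D\in\mathcal D(\lambda)$ for which there is $l\ge0$ with $\sigma^{\lambda,l}(D)<\infty$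 such that the limit function $f(s)=\lim_{x\to\infty}R^{\lambda,l}_x(D)(s)$, $s\in\mathbb C_{\sigma^{\lambda,l}(D)}$, has a holomorphic extension to $\mathbb C_0$, again denoted $f=f_D$ (it does not depend on $l$), satisfying $$\|D\|_{\mathcal D^{\mathrm{ext}}_{\infty,k}(\lambda)}:=\sup_{s\in\mathbb C_0}\frac{|f_D(s)|}{(1+|s|)^k}<\infty.$$ This is a norm. $R^{\lambda,k}_x$ is regarded as the linear operator on $\mathcal D^{\mathrm{ext}}_{\infty,k}(\lambda)$ sending $D$ to the Dirichlet polynomial $R^{\lambda,k}_x(D)$, and $\|\cdot\|_{\mathcal L(\mathcal D^{\mathrm{ext}}_{\infty,k}(\lambda))}$ is the operator norm, so that $$\|R^{\lambda,k}_x\|_{\mathcal L(\mathcal D^{\mathrm{ext}}_{\infty,k}(\lambda))}=\sup_{\|D\|\le1}\ \sup_{s\in\mathbb C_0}\frac{|R^{\lambda,k}_x(D)(s)|}{(1+|s|)^k}.$$ *)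

theory Defs
  imports "HOL-Complex_Analysis.Complex_Analysis"
begin

text \<open>
  All sequences are indexed by the positive integers. They are represented as functions on
  \<^typ>\<open>nat\<close> whose value at \<open>0\<close> is never used; every index set below is restricted to \<open>n \<ge> 1\<close>.
  A formal Dirichlet series over the frequency \<open>lam\<close> is its coefficient sequence
  \<open>D :: nat \<Rightarrow> complex\<close>.
\<close>

definition frequency :: "(nat \<Rightarrow> real) \<Rightarrow> bool" where
  "frequency lam \<longleftrightarrow>
     (\<forall>n\<ge>1. 0 \<le> lam n) \<and> strict_mono_on {1..} lam \<and> filterlim lam at_top sequentially"

definition eps :: "(nat \<Rightarrow> real) \<Rightarrow> nat \<Rightarrow> real" where
  "eps lam n =
     (if n = 1 then min 1 (lam 2 - lam 1)
      else Min {1, lam n - lam (n - 1), lam (n + 1) - lam n})"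

text \<open>The convention \<open>0\<^sup>0 = 1\<close> is needed for Riesz means, but \<open>0 powr 0 = 0\<close>.\<close>

definition riesz_weight :: "(nat \<Rightarrow> real) \<Rightarrow> real \<Rightarrow> real \<Rightarrow> nat \<Rightarrow> real" where
  "riesz_weight lam l x n = (if l = 0 then 1 else (1 - lam n / x) powr l)"

definition riesz_mean ::
  "(nat \<Rightarrow> real) \<Rightarrow> real \<Rightarrow> real \<Rightarrow> (nat \<Rightarrow> complex) \<Rightarrow> complex \<Rightarrow> complex" where
  "riesz_mean lam l x D s =
     (\<Sum>n | 1 \<le> n \<and> lam n \<le> x.
        D n * of_real (riesz_weight lam l x n) * exp (- of_real (lam n) * s))"

definition riesz_summable ::
  "(nat \<Rightarrow> real) \<Rightarrow> real \<Rightarrow> (nat \<Rightarrow> complex) \<Rightarrow> complex \<Rightarrow> bool" where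
  "riesz_summable lam l D s \<longleftrightarrow> (\<exists>L. ((\<lambda>x. riesz_mean lam l x D s) \<longlongrightarrow> L) at_top)"

definition riesz_abscissa :: "(nat \<Rightarrow> real) \<Rightarrow> real \<Rightarrow> (nat \<Rightarrow> complex) \<Rightarrow> ereal" where
  "riesz_abscissa lam l D = (INF \<sigma> \<in> {\<sigma>::real. riesz_summable lam l D (of_real \<sigma>)}. ereal \<sigma>)"

text \<open>
  \<open>f\<close> is holomorphic on the right half-plane and extends a Riesz limit function of \<open>D\<close>. If the
  abscissa is negative, the limit function lives on a larger half-plane and \<open>f\<close> is its restriction.
  Only the values of \<open>f\<close> on the right half-plane matter, and there \<open>f\<close> is unique.
\<close>

definition extends_riesz_limit ::
  "(nat \<Rightarrow> real) \<Rightarrow> (nat \<Rightarrow> complex) \<Rightarrow> (complex \<Rightarrow> complex) \<Rightarrow> bool" where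
  "extends_riesz_limit lam D f \<longleftrightarrow>
     f holomorphic_on {s. 0 < Re s} \<and>
     (\<exists>l\<ge>0. riesz_abscissa lam l D < \<infinity> \<and>
        (\<forall>s. 0 < Re s \<and> riesz_abscissa lam l D < ereal (Re s) \<longrightarrow>
           ((\<lambda>x. riesz_mean lam l x D s) \<longlongrightarrow> f s) at_top))"

definition limit_fun :: "(nat \<Rightarrow> real) \<Rightarrow> (nat \<Rightarrow> complex) \<Rightarrow> complex \<Rightarrow> complex" where
  "limit_fun lam D = (SOME f. extends_riesz_limit lam D f)"

definition ext_norm :: "(nat \<Rightarrow> real) \<Rightarrow> real \<Rightarrow> (nat \<Rightarrow> complex) \<Rightarrow> ereal" where
  "ext_norm lam k D =
     (SUP s \<in> {s. 0 < Re s}. ereal (cmod (limit_fun lam D s) / (1 + cmod s) powr k))"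

definition ext_space :: "(nat \<Rightarrow> real) \<Rightarrow> real \<Rightarrow> (nat \<Rightarrow> complex) set" where
  "ext_space lam k = {D. (\<exists>f. extends_riesz_limit lam D f) \<and> ext_norm lam k D < \<infinity>}"

text \<open>The coefficient sequence of the Dirichlet polynomial \<open>riesz_mean lam l x D\<close>.\<close>

definition riesz_op ::
  "(nat \<Rightarrow> real) \<Rightarrow> real \<Rightarrow> real \<Rightarrow> (nat \<Rightarrow> complex) \<Rightarrow> (nat \<Rightarrow> complex)" where
  "riesz_op lam l x D =
     (\<lambda>n. if 1 \<le> n \<and> lam n \<le> x then D n * of_real (riesz_weight lam l x n) else 0)"

text \<open>Extended-real valued, so that an upper bound on the supremum includes its finiteness.\<close>

definition ext_op_norm ::
  "(nat \<Rightarrow> real) \<Rightarrow> real \<Rightarrow> ((nat \<Rightarrow> complex) \<Rightarrow> (nat \<Rightarrow> complex)) \<Rightarrow> ereal" where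
  "ext_op_norm lam k T =
     (SUP D \<in> {D \<in> ext_space lam k. ext_norm lam k D \<le> 1}. ext_norm lam k (T D))"

text \<open>If \<open>j < m j\<close> for all \<open>j \<ge> 1\<close>, the set is finite, so this is its maximum when it is nonempty.\<close>

definition m_tilde :: "(nat \<Rightarrow> nat) \<Rightarrow> nat \<Rightarrow> nat" where
  "m_tilde m n = Sup {j. 1 \<le> j \<and> m j \<le> n}"

end

theory Submission
  imports Defs "HOL-Probability.Sinc_Integral"
begin

text \<open>
  Write \<open>a\<^sub>j\<close> for the coefficients of \<open>D\<close>, \<open>f\<close> for its limit function and \<open>\<lambda>\<close> for the frequency. The Riesz mean
  of order \<open>k\<close> multiplies \<open>a\<^sub>j\<close> by \<open>((x - \<lambda>\<^sub>j) / x) powr k\<close>. The link to the growth of \<open>f\<close> is the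
  identity (\<open>multiplier_identity\<close>)
    \<open>\<integral> \<kappa>(t) f(s - i t) dt = \<Sum> a\<^sub>j \<mu>(\<lambda>\<^sub>j) exp(- \<lambda>\<^sub>j s)\<close>,
  where \<open>\<mu>(u) = \<integral> \<kappa>(t) exp(i u t) dt\<close> vanishes for large \<open>u\<close>: a multiplier \<open>\<mu>\<close> costs at most the weighted norm
  \<open>\<integral> \<bar>\<kappa>(t)\<bar> (1 + \<bar>t\<bar>)\<^sup>k dt\<close>. For a fixed bump, rescaled to width \<open>r\<close>, this norm is
  \<open>O(max(1, 1/r)\<^sup>k)\<close> wherever the bump is placed (\<open>bump_sum_bound\<close>).

  The Riesz weight is a superposition of such bumps over all widths,
    \<open>c y\<^sup>k = \<integral> r\<^sup>k \<Phi>(y/r) dr/r\<close> for \<open>y = x - u > 0\<close>,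
  with \<open>\<Phi>\<close> supported in a fixed interval \<open>[1, S]\<close> (\<open>scale_superposition\<close>). After division by \<open>x\<^sup>k\<close> a scale
  \<open>r \<le> x\<close> costs only \<open>O(dr/r)\<close>. The integral over all scales diverges logarithmically at \<open>r = 0\<close>, but a
  scale matters only if its bump is nonzero at some \<open>\<lambda>\<^sub>j\<close>, that is, if \<open>r\<close> lies between \<open>(x - \<lambda>\<^sub>j)/S\<close> and
  \<open>x - \<lambda>\<^sub>j\<close>. So \<open>R\<^sub>x\<close> is bounded by the logarithmic length of these scales (\<open>superposition_bound\<close>). For
  \<open>k = 0\<close> the weight jumps at \<open>x\<close>, and a coefficient with \<open>\<lambda>\<^sub>j = x\<close> is estimated by one narrow bump.

  It remains to count scales. Let \<open>\<lambda>\<^sub>n \<le> x \<le> \<lambda>\<^sub>n\<^sub>+\<^sub>1\<close>, let \<open>p\<close> be the largest index with \<open>m(p) \<le> n\<close>, and put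
  \<open>\<delta> = \<lambda>(m(p)) - \<lambda>(p)\<close>. The indices \<open>j \<le> p\<close> have \<open>\<delta> \<le> x - \<lambda>\<^sub>j \<le> x\<close> and together occupy
  a logarithmic length of \<open>log(x S/\<delta>)\<close>; each of the \<open>n - p\<close> other indices adds \<open>log S\<close>. On the right-hand
  side, the summand \<open>l = p\<close> contains \<open>log(\<lambda>(m(p))/\<delta>)\<close>, each summand \<open>l > p\<close> is at least
  \<open>\<lambda>\<^sub>2 / (\<lambda>\<^sub>2 + 2)\<close> because \<open>\<lambda>(m(l)) - \<lambda>\<^sub>l \<le> 2\<close>, and \<open>x \<le> \<lambda>(m(p)) + 2\<close> because \<open>p\<close> is maximal.

  The identity for \<open>f\<close> is proved where the Riesz means converge. Means of sufficiently large integer order grow there only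
  polynomially on vertical lines, uniformly in \<open>x\<close> (\<open>riesz_mean_growth\<close>), so for rapidly decaying \<open>\<kappa>\<close> the limit
  may be taken under the integral. Multiplying \<open>\<kappa>\<close> by powers of \<open>sinc(h t)\<close> with \<open>h \<rightarrow> 0\<close> reduces general
  kernels to this case, and analytic continuation reaches the half-plane \<open>Re s > 0\<close>.
\<close>

section \<open>Fourier transforms and a band-limited bump\<close>

definition fourier :: "(real \<Rightarrow> complex) \<Rightarrow> real \<Rightarrow> complex" where
  "fourier \<kappa> u = (LINT t|lborel. \<kappa> t * cis (u * t))"

lemma borel_measurable_cis[measurable]: "cis \<in> borel_measurable borel"
  by (intro borel_measurable_continuous_onI continuous_intros)

lemma integrable_mult_bounded:
  fixes \<kappa> g :: "real \<Rightarrow> complex"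
  assumes "integrable lborel \<kappa>" "g \<in> borel_measurable borel" "\<And>t. norm (g t) \<le> B"
  shows "integrable lborel (\<lambda>t. \<kappa> t * g t)"
proof (rule Bochner_Integration.integrable_bound)
  show "integrable lborel (\<lambda>t. B *\<^sub>R norm (\<kappa> t))"
    using assms(1) by auto
  show "(\<lambda>t. \<kappa> t * g t) \<in> borel_measurable lborel"
    using assms(1,2) by measurable
  have "B \<ge> 0"
    using assms(3)[of 0] norm_ge_zero order_trans by blast
  then show "AE t in lborel. norm (\<kappa> t * g t) \<le> norm (B *\<^sub>R norm (\<kappa> t))"
    using assms(3) by (intro AE_I2) (simp add: norm_mult mult.commute[of "norm (\<kappa> _)"] mult_right_mono abs_mult)
qed

lemma integrable_weighted:
  fixes \<kappa> :: "real \<Rightarrow> complex"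
  assumes "\<kappa> \<in> borel_measurable borel" "integrable lborel (\<lambda>t. norm (\<kappa> t) * w t)" "\<And>t. w t \<ge> 1"
  shows "integrable lborel \<kappa>"
proof (rule Bochner_Integration.integrable_bound[OF assms(2)])
  show "\<kappa> \<in> borel_measurable lborel"
    using assms(1) by simp
  show "AE t in lborel. norm (\<kappa> t) \<le> norm (norm (\<kappa> t) * w t)"
  proof (intro AE_I2)
    fix t
    have "norm (\<kappa> t) * 1 \<le> norm (\<kappa> t) * w t"
      using assms(3) by (intro mult_left_mono) auto
    moreover have "0 \<le> w t"
      using assms(3)[of t] by linarith
    ultimately show "norm (\<kappa> t) \<le> norm (norm (\<kappa> t) * w t)"
      by (simp add: abs_mult)
  qed
qed

lemma cis_integral_eq_sinc:
  assumes "h > 0"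
  shows "(LINT v|lborel. indicator {-h..h} v *\<^sub>R cis (v * t)) = of_real (2 * h * sinc (h * t))"
proof (cases "t = 0")
  case True
  then show ?thesis using assms by (simp add: scaleR_conv_of_real)
next
  case False
  have "(LINT v|lborel. indicator {-h..h} v *\<^sub>R cis (v * t)) = cis (h * t) / (\<i> * t) - cis (- h * t) / (\<i> * t)"
  proof (rule integral_FTC_Icc)
    show "((\<lambda>v. cis (v * t) / (\<i> * t)) has_vector_derivative cis (v * t)) (at v within {-h..h})" for v
    proof -
      have "((\<lambda>z. exp (\<i> * (z * t)) / (\<i> * t)) has_field_derivative cis (v * t)) (at (of_real v))"
        using False by (auto intro!: derivative_eq_intros simp: cis_conv_exp field_simps)
      from has_vector_derivative_real_field[OF this] show ?thesis
        by (simp add: cis_conv_exp)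
    qed
  qed (use assms in \<open>auto intro!: continuous_intros\<close>)
  also have "\<dots> = of_real (2 * h * sinc (h * t))"
  proof -
    have "cis (h * t) - cis (- h * t) = \<i> * of_real (2 * sin (h * t))"
      by (simp add: complex_eq_iff)
    then show ?thesis using False assms by (simp add: diff_divide_distrib[symmetric])
  qed
  finally show ?thesis .
qed

text \<open>
  Multiplication by \<open>sinc (h t)\<close> averages the transform over \<open>[u - h, u + h]\<close>. This gains one order of decay of the
  kernel while the support of the transform grows by only \<open>h\<close>; both the construction of the bump and
  the regularisation of general kernels rest on it.
\<close>
lemma fourier_sinc_eq_average:
  fixes \<kappa> :: "real \<Rightarrow> complex"
  assumes \<kappa>: "integrable lborel \<kappa>" and h: "h > 0"
  shows "fourier (\<lambda>t. \<kappa> t * of_real (sinc (h * t))) u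
    = (LINT v|lborel. indicator {-h..h} v *\<^sub>R fourier \<kappa> (u + v)) / of_real (2 * h)"
proof -
  have [measurable]: "\<kappa> \<in> borel_measurable borel"
    using \<kappa> by auto
  let ?F = "\<lambda>(v, t). indicator {-h..h} v *\<^sub>R (\<kappa> t * cis ((u + v) * t))"
  have ind: "integrable lborel (\<lambda>v::real. indicator {-h..h} v :: real)"
    using h by (intro integrable_real_indicator) auto
  have int: "integrable (lborel \<Otimes>\<^sub>M lborel) ?F"
  proof (rule lborel_pair.Fubini_integrable)
    show "?F \<in> borel_measurable (lborel \<Otimes>\<^sub>M lborel)"
      by measurable
    have "(\<lambda>v. LINT t|lborel. norm (?F (v, t))) = (\<lambda>v. indicator {-h..h} v * (LINT t|lborel. norm (\<kappa> t)))"
      by (auto simp: norm_mult)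
    then show "integrable lborel (\<lambda>v. LINT t|lborel. norm (?F (v, t)))"
      using ind by (simp only: integrable_mult_left)
    show "AE v in lborel. integrable lborel (\<lambda>t. ?F (v, t))"
      by (intro AE_I2) (auto intro!: integrable_scaleR_right integrable_mult_bounded[OF \<kappa>, where B=1])
  qed
  have "(LINT v|lborel. indicator {-h..h} v *\<^sub>R fourier \<kappa> (u + v)) = (LINT v|lborel. LINT t|lborel. ?F (v, t))"
    unfolding fourier_def by simp
  also have "\<dots> = (LINT t|lborel. LINT v|lborel. ?F (v, t))"
    using lborel_pair.Fubini_integral[of "\<lambda>v t. ?F (v, t)"] int by simp
  also have "\<dots> = (LINT t|lborel. of_real (2 * h) * (\<kappa> t * of_real (sinc (h * t)) * cis (u * t)))"
  proof (rule Bochner_Integration.integral_cong[OF refl])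
    fix t :: real
    have "(LINT v|lborel. ?F (v, t)) = (LINT v|lborel. (\<kappa> t * cis (u * t)) * (indicator {-h..h} v *\<^sub>R cis (v * t)))"
      by (intro Bochner_Integration.integral_cong refl) (auto simp: distrib_right cis_mult[symmetric] indicator_def)
    also have "\<dots> = (\<kappa> t * cis (u * t)) * of_real (2 * h * sinc (h * t))"
      by (subst integral_mult_right_zero, subst cis_integral_eq_sinc[OF h]) simp
    finally show "(LINT v|lborel. ?F (v, t)) = of_real (2 * h) * (\<kappa> t * of_real (sinc (h * t)) * cis (u * t))"
      by (simp add: mult_ac)
  qed
  also have "\<dots> = of_real (2 * h) * fourier (\<lambda>t. \<kappa> t * of_real (sinc (h * t))) u"
    unfolding fourier_def by simp
  finally show ?thesis using h by (simp add: field_simps)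
qed

lemma abs_sinc_le_1: "\<bar>sinc x\<bar> \<le> 1"
  using abs_sin_x_le_abs_x[of x] by (auto simp: divide_simps)

lemma abs_sinc_mult_le: "\<bar>sinc x\<bar> * (1 + \<bar>x\<bar>) \<le> 2"
proof (cases "x = 0")
  case False
  then have "\<bar>sinc x\<bar> * \<bar>x\<bar> = \<bar>sin x\<bar>"
    by simp
  also have "\<dots> \<le> 1" by simp
  finally show ?thesis using abs_sinc_le_1[of x] by (simp add: distrib_left)
qed auto

lemma fourier_sinc_eq_0:
  fixes \<kappa> :: "real \<Rightarrow> complex"
  assumes "integrable lborel \<kappa>" "h > 0" "\<And>u. u \<ge> U \<Longrightarrow> fourier \<kappa> u = 0" "u \<ge> U + h"
  shows "fourier (\<lambda>t. \<kappa> t * of_real (sinc (h * t))) u = 0"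
proof -
  have "(LINT v|lborel. indicator {-h..h} v *\<^sub>R fourier \<kappa> (u + v)) = integral\<^sup>L lborel (\<lambda>v::real. 0::complex)"
    using assms(3,4) by (intro Bochner_Integration.integral_cong refl) (auto simp: indicator_def)
  then show ?thesis
    using fourier_sinc_eq_average[OF assms(1,2), of u] by simp
qed

lemma integrable_sinc_power:
  fixes \<kappa> :: "real \<Rightarrow> complex"
  assumes "integrable lborel \<kappa>"
  shows "integrable lborel (\<lambda>t. \<kappa> t * of_real (sinc (h * t)) ^ n)"
proof (rule integrable_mult_bounded[OF assms, where B=1])
  show "norm (complex_of_real (sinc (h * t)) ^ n) \<le> 1" for t
    unfolding norm_power norm_of_real by (intro power_le_one abs_sinc_le_1 abs_ge_zero)
qed measurable

lemma fourier_sinc_power_eq_0: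
  fixes \<kappa> :: "real \<Rightarrow> complex"
  assumes "integrable lborel \<kappa>" "h > 0" "\<And>u. u \<ge> U \<Longrightarrow> fourier \<kappa> u = 0" "u \<ge> U + real n * h"
  shows "fourier (\<lambda>t. \<kappa> t * of_real (sinc (h * t)) ^ n) u = 0"
  using assms(4)
proof (induction n arbitrary: u)
  case 0
  then show ?case using assms(3)[of u] by simp
next
  case (Suc n)
  have "fourier (\<lambda>t. (\<kappa> t * of_real (sinc (h * t)) ^ n) * of_real (sinc (h * t))) u = 0"
    using Suc by (intro fourier_sinc_eq_0[OF integrable_sinc_power[OF assms(1)] assms(2), where U = "U + real n * h"])
      (auto simp: algebra_simps)
  moreover have "(\<lambda>t. (\<kappa> t * of_real (sinc (h * t)) ^ n) * of_real (sinc (h * t)))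
     = (\<lambda>t. \<kappa> t * complex_of_real (sinc (h * t)) ^ Suc n)"
    by (rule ext) (simp only: power_Suc mult_ac)
  ultimately show ?case by simp
qed

lemma fourier_scale_modulate:
  assumes "r > 0"
  shows "fourier (\<lambda>t. of_real r * \<kappa> (r * t) * cis (- c * t)) u = fourier \<kappa> ((u - c) / r)"
proof -
  have "fourier \<kappa> ((u - c) / r) = \<bar>r\<bar> *\<^sub>R (LINT t|lborel. \<kappa> (0 + r * t) * cis ((u - c) / r * (0 + r * t)))"
    unfolding fourier_def using assms by (intro lborel_integral_real_affine) auto
  also have "\<dots> = (LINT t|lborel. \<bar>r\<bar> *\<^sub>R (\<kappa> (0 + r * t) * cis ((u - c) / r * (0 + r * t))))"
    by simp
  also have "\<dots> = fourier (\<lambda>t. of_real r * \<kappa> (r * t) * cis (- c * t)) u"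
    unfolding fourier_def
  proof (intro Bochner_Integration.integral_cong refl)
    fix t
    have "(u - c) / r * (0 + r * t) = - c * t + u * t"
      using assms by (simp add: field_simps)
    then show "\<bar>r\<bar> *\<^sub>R (\<kappa> (0 + r * t) * cis ((u - c) / r * (0 + r * t)))
       = of_real r * \<kappa> (r * t) * cis (- c * t) * cis (u * t)"
      using assms by (simp add: scaleR_conv_of_real cis_mult mult.assoc)
  qed
  finally show ?thesis ..
qed

lemma continuous_fourier:
  fixes \<kappa> :: "real \<Rightarrow> complex"
  assumes "integrable lborel \<kappa>"
  shows "continuous_on UNIV (fourier \<kappa>)"
proof -
  have [measurable]: "\<kappa> \<in> borel_measurable borel"
    using assms by auto
  show ?thesis
    unfolding continuous_on_sequentially comp_def
  proof (intro allI ballI impI)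
    fix x and a :: real
    assume "(\<forall>n. x n \<in> UNIV) \<and> x \<longlonglongrightarrow> a"
    then have x: "x \<longlonglongrightarrow> a" by simp
    show "(\<lambda>n. fourier \<kappa> (x n)) \<longlonglongrightarrow> fourier \<kappa> a"
      unfolding fourier_def
    proof (rule integral_dominated_convergence[where w = "\<lambda>t. norm (\<kappa> t)"])
      show "AE t in lborel. (\<lambda>i. \<kappa> t * cis (x i * t)) \<longlonglongrightarrow> \<kappa> t * cis (a * t)"
        unfolding cis_conv_exp by (intro AE_I2 tendsto_intros x)
    qed (use assms in \<open>auto simp: norm_mult\<close>)
  qed
qed

lemma fejer_integrable: "integrable lborel (\<lambda>t::real. (1 - cos t) / t\<^sup>2)"
proof (rule Bochner_Integration.integrable_bound)
  have "integrable lborel (\<lambda>t::real. inverse (1 + t\<^sup>2))"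
    using integrable_inverse_1_plus_square by (simp add: set_integrable_def)
  then show "integrable lborel (\<lambda>t::real. 4 * inverse (1 + t\<^sup>2))"
    by auto
  show "AE t in lborel. norm ((1 - cos t) / t\<^sup>2) \<le> norm (4 * inverse (1 + t\<^sup>2) :: real)"
  proof (intro AE_I2)
    fix t :: real
    show "norm ((1 - cos t) / t\<^sup>2) \<le> norm (4 * inverse (1 + t\<^sup>2) :: real)"
    proof (cases "t = 0")
      case False
      have 1: "1 - cos t \<le> t\<^sup>2 / 2"
        using cos_double_sin[of "t / 2"] abs_sin_x_le_abs_x[of "t / 2"] power_mono[of "\<bar>sin (t/2)\<bar>" "\<bar>t/2\<bar>" 2]
        by (simp add: power_divide)
      have 2: "1 - cos t \<le> 2"
        using cos_ge_minus_one[of t] by linarith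
      have "(1 - cos t) * (1 + t\<^sup>2) = (1 - cos t) + (1 - cos t) * t\<^sup>2"
        by (simp add: algebra_simps)
      also have "\<dots> \<le> t\<^sup>2 / 2 + 2 * t\<^sup>2"
        using 1 2 by (intro add_mono mult_right_mono) auto
      also have "\<dots> \<le> 4 * t\<^sup>2" by simp
      finally show ?thesis
        using False by (auto simp: field_simps abs_mult add_pos_nonneg)
    qed auto
  qed
qed measurable

text \<open>
  The transform of the Fejer kernel is obtained without any inversion theorem: the integral
  of \<open>(1 - cos (a t)) / t\<^sup>2\<close> is homogeneous in \<open>a\<close>, and \<open>(1 - cos t) cos (u t)\<close> is a linear combination of
  \<open>1 - cos (a t)\<close> for \<open>a = u - 1, u, u + 1\<close>. Of the integral at \<open>a = 1\<close>
  only positivity has to be known.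
\<close>
lemma fejer_scaling: "(LINT t|lborel. (1 - cos (a * t)) / t\<^sup>2) = \<bar>a\<bar> * (LINT t|lborel. (1 - cos t) / t\<^sup>2)"
  and fejer_integrable_scaled: "integrable lborel (\<lambda>t::real. (1 - cos (a * t)) / t\<^sup>2)"
proof -
  have "(LINT t|lborel. (1 - cos (a * t)) / t\<^sup>2) = \<bar>a\<bar> * (LINT t|lborel. (1 - cos t) / t\<^sup>2)
    \<and> integrable lborel (\<lambda>t::real. (1 - cos (a * t)) / t\<^sup>2)"
  proof (cases "a = 0")
    case False
    have eq: "(1 - cos (a * t)) / t\<^sup>2 = a\<^sup>2 * ((1 - cos (0 + a * t)) / (0 + a * t)\<^sup>2)" for t
      using False by (simp add: power_mult_distrib)
    have i: "integrable lborel (\<lambda>t. (1 - cos (0 + a * t)) / (0 + a * t)\<^sup>2)"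
      by (rule lborel_integrable_real_affine[OF fejer_integrable False])
    have "(LINT t|lborel. (1 - cos t) / t\<^sup>2) = \<bar>a\<bar> * (LINT t|lborel. (1 - cos (0 + a * t)) / (0 + a * t)\<^sup>2)"
      using lborel_integral_real_affine[OF False, of "\<lambda>t. (1 - cos t) / t\<^sup>2" 0] by simp
    then have "\<bar>a\<bar> * (LINT t|lborel. (1 - cos t) / t\<^sup>2) = a\<^sup>2 * (LINT t|lborel. (1 - cos (0 + a * t)) / (0 + a * t)\<^sup>2)"
      by (simp add: mult.assoc[symmetric] power2_eq_square)
    moreover have "(LINT t|lborel. (1 - cos (a * t)) / t\<^sup>2) = a\<^sup>2 * (LINT t|lborel. (1 - cos (0 + a * t)) / (0 + a * t)\<^sup>2)"
      unfolding eq by (rule integral_mult_right_zero)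
    ultimately show ?thesis
      unfolding eq using integrable_mult_right[OF i, of "a\<^sup>2"] by simp
  qed auto
  then show "(LINT t|lborel. (1 - cos (a * t)) / t\<^sup>2) = \<bar>a\<bar> * (LINT t|lborel. (1 - cos t) / t\<^sup>2)"
    "integrable lborel (\<lambda>t::real. (1 - cos (a * t)) / t\<^sup>2)"
    by auto
qed

lemma integral_continuous_nonneg_pos:
  fixes f :: "real \<Rightarrow> real"
  assumes f: "continuous_on UNIV f" "\<And>x. f x \<ge> 0" "f c > 0" and ab: "a < c" "c < b"
    and int: "integrable lborel (\<lambda>x. indicator {a..b} x * f x)"
  shows "(LINT x|lborel. indicator {a..b} x * f x) > 0"
proof -
  have "isCont f c"
    using f(1) by (simp add: continuous_on_eq_continuous_at)
  then have "\<forall>\<^sub>F x in at c. f x > f c / 2"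
    using f(3) unfolding isCont_def by (intro order_tendstoD(1)) auto
  then obtain d where d: "d > 0" "\<And>x. x \<noteq> c \<Longrightarrow> dist x c < d \<Longrightarrow> f x > f c / 2"
    unfolding eventually_at by auto
  define e where "e = min (d / 2) (min (c - a) (b - c))"
  have e: "e > 0" "e \<le> d / 2" "e \<le> c - a" "e \<le> b - c"
    using d(1) ab unfolding e_def by linarith+
  have "0 < 2 * e * (f c / 2)"
    using e f(3) by simp
  also have "\<dots> = (LINT x|lborel. indicator {c - e..c + e} x * (f c / 2))"
    using e by simp
  also have "\<dots> \<le> (LINT x|lborel. indicator {a..b} x * f x)"
  proof (rule integral_mono[OF _ int])
    show "integrable lborel (\<lambda>x. indicator {c - e..c + e} x * (f c / 2))"
      using e by (intro integrable_mult_left integrable_real_indicator) auto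
    fix x
    show "indicator {c - e..c + e} x * (f c / 2) \<le> indicator {a..b} x * f x"
    proof (cases "x \<in> {c - e..c + e}")
      case True
      then have "dist x c < d" using e by (auto simp: dist_real_def)
      then have "f x \<ge> f c / 2" using d(2)[of x] f(3) by (cases "x = c") auto
      then show ?thesis using True e by (auto simp: indicator_def)
    qed (use f(2) in auto)
  qed
  finally show ?thesis .
qed

text \<open>
  This is \<open>(1 - cos t) / t\<^sup>2\<close>; the form with \<open>sinc\<close> is continuous at \<open>0\<close>.
\<close>
definition fejer :: "real \<Rightarrow> complex" where
  "fejer t = of_real ((sinc (t / 2))\<^sup>2 / 2)"

lemma fejer_AE: "AE t in lborel. (sinc (t / 2))\<^sup>2 / 2 = (1 - cos t) / t\<^sup>2"
  using AE_lborel_singleton[of 0]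
proof eventually_elim
  case (elim t)
  then show ?case
    using cos_double_sin[of "t / 2"] by (simp add: power_divide)
qed

lemma integrable_fejer: "integrable lborel fejer"
proof -
  have "integrable lborel (\<lambda>t. (sinc (t / 2))\<^sup>2 / 2)"
    using fejer_integrable by (rule integrable_cong_AE_imp) (use fejer_AE in auto)
  then show ?thesis
    unfolding fejer_def by (rule integrable_of_real)
qed

lemma fourier_fejer:
  "fourier fejer u = of_real ((LINT t|lborel. (1 - cos t) / t\<^sup>2) * max 0 (1 - \<bar>u\<bar>))"
proof -
  let ?J = "(LINT t|lborel. (1 - cos t) / t\<^sup>2 :: real)"
  let ?g = "\<lambda>t. (1 - cos t) / t\<^sup>2 :: real"
  have isin: "integrable lborel (\<lambda>t. ?g t * sin (u * t))" and icos: "integrable lborel (\<lambda>t. ?g t * cos (u * t))"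
    by (rule Bochner_Integration.integrable_bound[OF fejer_integrable]; simp add: abs_mult mult_left_le divide_right_mono)+
  have "fourier fejer u = (LINT t|lborel. of_real (?g t) * cis (u * t))"
    unfolding fourier_def
  proof (rule integral_cong_AE)
    show "AE t in lborel. fejer t * cis (u * t) = of_real (?g t) * cis (u * t)"
      using fejer_AE unfolding fejer_def by eventually_elim (simp only:)
  qed (auto simp: fejer_def)
  also have "\<dots> = (LINT t|lborel. of_real (?g t * cos (u * t)) + \<i> * of_real (?g t * sin (u * t)))"
    by (intro Bochner_Integration.integral_cong refl) (simp add: complex_eq_iff)
  also have "\<dots> = (LINT t|lborel. of_real (?g t * cos (u * t))) + (LINT t|lborel. \<i> * of_real (?g t * sin (u * t)))"
    using isin icos by (intro Bochner_Integration.integral_add integrable_of_real integrable_mult_right) auto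
  also have "\<dots> = of_real (LINT t|lborel. ?g t * cos (u * t)) + \<i> * of_real (LINT t|lborel. ?g t * sin (u * t))"
    by (simp only: integral_complex_of_real integral_mult_right_zero)
  also have "(LINT t|lborel. ?g t * sin (u * t)) = 0"
  proof -
    have "(LINT t|lborel. ?g t * sin (u * t)) = - (LINT t|lborel. ?g t * sin (u * t))"
      using lborel_integral_real_affine[of "-1" "\<lambda>t. ?g t * sin (u * t)" 0] by simp
    then show ?thesis by simp
  qed
  also have "(LINT t|lborel. ?g t * cos (u * t)) = ?J * max 0 (1 - \<bar>u\<bar>)"
  proof -
    let ?h = "\<lambda>a t. (1 - cos (a * t)) / t\<^sup>2 :: real"
    have "?g t * cos (u * t) = ?h (u + 1) t / 2 + ?h (u - 1) t / 2 - ?h u t" for t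
      by (simp add: cos_add cos_diff distrib_right left_diff_distrib diff_divide_distrib add_divide_distrib)
    then have "(LINT t|lborel. ?g t * cos (u * t)) = (LINT t|lborel. ?h (u + 1) t / 2 + ?h (u - 1) t / 2 - ?h u t)"
      by presburger
    also have "\<dots> = (LINT t|lborel. ?h (u + 1) t) / 2 + (LINT t|lborel. ?h (u - 1) t) / 2 - (LINT t|lborel. ?h u t)"
      using fejer_integrable_scaled[of "u + 1"] fejer_integrable_scaled[of "u - 1"] fejer_integrable_scaled[of u]
      by (intro trans[OF Bochner_Integration.integral_diff] arg_cong2[where f="(-)"] refl
        trans[OF Bochner_Integration.integral_add] arg_cong2[where f="(+)"] integral_divide_zero
        Bochner_Integration.integrable_add integrable_divide) assumption+
    also have "\<dots> = ?J * (\<bar>u + 1\<bar> / 2 + \<bar>u - 1\<bar> / 2 - \<bar>u\<bar>)"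
      unfolding fejer_scaling by (simp add: algebra_simps)
    also have "\<bar>u + 1\<bar> / 2 + \<bar>u - 1\<bar> / 2 - \<bar>u\<bar> = max 0 (1 - \<bar>u\<bar>)"
      by (auto simp: max_def abs_if field_simps)
    finally show ?thesis .
  qed
  finally show ?thesis by simp
qed

lemma fejer_mass_pos: "(LINT t|lborel. (1 - cos t) / t\<^sup>2 :: real) > 0"
proof -
  let ?f = "\<lambda>t. (sinc (t / 2))\<^sup>2 / 2"
  have i: "integrable lborel ?f"
    using fejer_integrable by (rule integrable_cong_AE_imp) (use fejer_AE in auto)
  have i2: "integrable lborel (\<lambda>t. indicator {-1..1} t * ?f t)"
    using integrable_mult_indicator[OF _ i, of "{-1..1}"] by simp
  have "0 < (LINT t|lborel. indicator {-1..1} t * ?f t)"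
  proof (rule integral_continuous_nonneg_pos[where c=0])
    show "continuous_on UNIV ?f"
      by (intro continuous_intros) auto
  qed (use i2 in auto)
  also have "\<dots> \<le> (LINT t|lborel. ?f t)"
    by (rule integral_mono[OF i2 i]) (auto simp: indicator_def)
  also have "\<dots> = (LINT t|lborel. (1 - cos t) / t\<^sup>2)"
    by (rule integral_cong_AE) (use fejer_AE in auto)
  finally show ?thesis .
qed

text \<open>
  A nonnegative bump of compact support whose kernel has \<open>M\<close> finite absolute moments: start with the tent
  function, the transform of the Fejer kernel, and average it \<open>M\<close> times over intervals of length \<open>2\<close>.
\<close>
lemma exists_band_limited_bump:
  "\<exists>\<kappa> \<phi> A. continuous_on UNIV \<kappa> \<and> integrable lborel (\<lambda>t. norm (\<kappa> t) * (1 + \<bar>t\<bar>) ^ M)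
     \<and> (\<forall>u. fourier \<kappa> u = complex_of_real (\<phi> u)) \<and> (\<forall>u. 0 \<le> \<phi> u) \<and> 0 < \<phi> 0
     \<and> 0 < A \<and> (\<forall>u. A \<le> \<bar>u\<bar> \<longrightarrow> \<phi> u = 0)"
proof (induction M)
  case 0
  have "continuous_on UNIV fejer"
    unfolding fejer_def by (intro continuous_intros) auto
  moreover have "integrable lborel (\<lambda>t. norm (fejer t) * (1 + \<bar>t\<bar>) ^ 0)"
    using integrable_fejer by simp
  moreover have "\<forall>u. 1 \<le> \<bar>u\<bar> \<longrightarrow> (LINT t|lborel. (1 - cos t) / t\<^sup>2 :: real) * max 0 (1 - \<bar>u\<bar>) = 0"
    by auto
  ultimately show ?case
    using fejer_mass_pos
    by (intro exI[of _ fejer] exI[of _ "\<lambda>u. (LINT t|lborel. (1 - cos t) / t\<^sup>2) * max 0 (1 - \<bar>u\<bar>)"] exI[of _ "1::real"])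
      (simp add: fourier_fejer)
next
  case (Suc M)
  then obtain \<kappa> \<phi> A where \<kappa>: "continuous_on UNIV \<kappa>" "integrable lborel (\<lambda>t. norm (\<kappa> t) * (1 + \<bar>t\<bar>) ^ M)"
     and \<phi>: "\<And>u. fourier \<kappa> u = complex_of_real (\<phi> u)" "\<And>u. 0 \<le> \<phi> u" "0 < \<phi> 0"
     and A: "0 < A" "\<And>u. A \<le> \<bar>u\<bar> \<Longrightarrow> \<phi> u = 0"
    by blast
  have m[measurable]: "\<kappa> \<in> borel_measurable borel"
    using \<kappa>(1) by (rule borel_measurable_continuous_onI)
  have i: "integrable lborel \<kappa>"
    by (rule integrable_weighted[OF m \<kappa>(2)]) auto
  have cont: "continuous_on UNIV \<phi>"
    using continuous_on_Re[OF continuous_fourier[OF i]] \<phi>(1) by (simp add: fun_eq_iff)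
  define \<psi> where "\<psi> u = (LINT v|lborel. indicator {-1..1} v * \<phi> (u + v)) / 2" for u
  have c2: "continuous_on UNIV (\<lambda>v. \<phi> (u + v))" for u
    by (rule continuous_on_compose2[OF cont]) (auto intro: continuous_intros)
  have ind: "integrable lborel (\<lambda>v. indicator {-1..1} v * \<phi> (u + v))" for u
    using borel_integrable_atLeastAtMost'[OF continuous_on_subset[OF c2[of u]], of "-1" 1]
    by (simp add: set_integrable_def)
  let ?\<kappa> = "\<lambda>t. \<kappa> t * complex_of_real (sinc (1 * t))"
  have "fourier ?\<kappa> u = complex_of_real (\<psi> u)" for u
  proof -
    have "(LINT v|lborel. indicator {-1..1} v *\<^sub>R complex_of_real (\<phi> (u + v)))
       = (LINT v|lborel. complex_of_real (indicator {-1..1} v * \<phi> (u + v)))"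
      by (intro Bochner_Integration.integral_cong refl) (simp add: scaleR_conv_of_real)
    also have "\<dots> = complex_of_real (\<psi> u) * 2"
      unfolding integral_complex_of_real \<psi>_def by simp
    finally show ?thesis
      using fourier_sinc_eq_average[OF i, of 1 u] by (simp add: \<phi>(1))
  qed
  moreover have "continuous_on UNIV ?\<kappa>"
    by (intro continuous_intros \<kappa>)
  moreover have "integrable lborel (\<lambda>t. norm (?\<kappa> t) * (1 + \<bar>t\<bar>) ^ Suc M)"
  proof (rule Bochner_Integration.integrable_bound)
    show "integrable lborel (\<lambda>t. 2 * (norm (\<kappa> t) * (1 + \<bar>t\<bar>) ^ M))"
      using \<kappa>(2) by simp
    show "AE t in lborel. norm (norm (?\<kappa> t) * (1 + \<bar>t\<bar>) ^ Suc M) \<le> norm (2 * (norm (\<kappa> t) * (1 + \<bar>t\<bar>) ^ M))"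
    proof (intro AE_I2)
      fix t :: real
      have "norm (norm (?\<kappa> t) * (1 + \<bar>t\<bar>) ^ Suc M) = (\<bar>sinc t\<bar> * (1 + \<bar>t\<bar>)) * (norm (\<kappa> t) * (1 + \<bar>t\<bar>) ^ M)"
        by (simp add: norm_mult abs_mult norm_divide)
      also have "\<dots> \<le> 2 * (norm (\<kappa> t) * (1 + \<bar>t\<bar>) ^ M)"
        by (intro mult_right_mono abs_sinc_mult_le) auto
      finally show "norm (norm (?\<kappa> t) * (1 + \<bar>t\<bar>) ^ Suc M) \<le> norm (2 * (norm (\<kappa> t) * (1 + \<bar>t\<bar>) ^ M))"
        by (simp add: abs_mult)
    qed
  qed measurable
  moreover have "0 \<le> \<psi> u" for u
    unfolding \<psi>_def using \<phi>(2) by (intro divide_nonneg_nonneg Bochner_Integration.integral_nonneg) auto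
  moreover have "0 < \<psi> 0"
    unfolding \<psi>_def using \<phi>
    by (intro divide_pos_pos integral_continuous_nonneg_pos[where c=0] c2 ind) auto
  moreover have "\<psi> u = 0" if "A + 1 \<le> \<bar>u\<bar>" for u
  proof -
    have "(LINT v|lborel. indicator {-1..1} v * \<phi> (u + v)) = integral\<^sup>L lborel (\<lambda>v::real. 0)"
      using A(2) that by (intro Bochner_Integration.integral_cong refl) (auto simp: indicator_def)
    then show ?thesis by (simp add: \<psi>_def)
  qed
  ultimately show ?case
    using A(1) by (intro exI[of _ ?\<kappa>] exI[of _ \<psi>] exI[of _ "A + 1"]) auto
qed

section \<open>Riesz means of different orders\<close>

lemma finite_frequency_le:
  assumes "frequency lam"
  shows "finite {n. 1 \<le> n \<and> lam n \<le> x}"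
proof -
  have "\<forall>\<^sub>F n in sequentially. lam n > x"
    using assms unfolding frequency_def filterlim_at_top_dense by blast
  then obtain N where "\<And>n. n \<ge> N \<Longrightarrow> lam n > x"
    unfolding eventually_sequentially by blast
  then have "{n. 1 \<le> n \<and> lam n \<le> x} \<subseteq> {..<N}"
    by (metis (no_types, lifting) lessThan_iff linorder_not_le mem_Collect_eq subsetI)
  then show ?thesis by (rule finite_subset) auto
qed

lemma frequency_nonneg: "frequency lam \<Longrightarrow> 1 \<le> n \<Longrightarrow> 0 \<le> lam n"
  by (simp add: frequency_def)

lemma frequency_less: "frequency lam \<Longrightarrow> 1 \<le> i \<Longrightarrow> i < j \<Longrightarrow> lam i < lam j"
  unfolding frequency_def using strict_mono_onD[of "{1..}" lam i j] by simp

lemma frequency_le: "frequency lam \<Longrightarrow> 1 \<le> i \<Longrightarrow> i \<le> j \<Longrightarrow> lam i \<le> lam j"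
  using frequency_less[of lam i j] by (cases "i = j") auto

lemma riesz_weight_bounds:
  assumes "0 \<le> lam n" "lam n \<le> x" "0 \<le> l"
  shows "0 \<le> riesz_weight lam l x n" "riesz_weight lam l x n \<le> 1"
proof -
  have "0 \<le> lam n / x" "lam n / x \<le> 1"
    using assms by (auto simp: divide_le_eq_1)
  then show "0 \<le> riesz_weight lam l x n" "riesz_weight lam l x n \<le> 1"
    using assms(3) powr_mono2[of l "1 - lam n / x" 1] by (auto simp: riesz_weight_def)
qed

lemma norm_riesz_mean_le:
  assumes "frequency lam" "0 \<le> l" "x \<le> X"
  shows "norm (riesz_mean lam l x D s) \<le> (\<Sum>n | 1 \<le> n \<and> lam n \<le> X. norm (D n * exp (- of_real (lam n) * s)))"
proof -
  have "norm (riesz_mean lam l x D s) \<le> (\<Sum>n | 1 \<le> n \<and> lam n \<le> x. norm (D n * exp (- of_real (lam n) * s)))"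
    unfolding riesz_mean_def
  proof (rule order_trans[OF norm_sum sum_mono])
    fix n assume n: "n \<in> {n. 1 \<le> n \<and> lam n \<le> x}"
    then have "\<bar>riesz_weight lam l x n\<bar> \<le> 1"
      using riesz_weight_bounds[of lam n x l] frequency_nonneg[OF assms(1)] assms(2) by auto
    then have "norm (D n * exp (- of_real (lam n) * s)) * \<bar>riesz_weight lam l x n\<bar>
        \<le> norm (D n * exp (- of_real (lam n) * s)) * 1"
      by (intro mult_left_mono) auto
    then show "norm (D n * of_real (riesz_weight lam l x n) * exp (- of_real (lam n) * s))
       \<le> norm (D n * exp (- of_real (lam n) * s))"
      by (simp add: norm_mult mult_ac)
  qed
  also have "\<dots> \<le> (\<Sum>n | 1 \<le> n \<and> lam n \<le> X. norm (D n * exp (- of_real (lam n) * s)))"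
    using assms(3) finite_frequency_le[OF assms(1)] by (intro sum_mono2) auto
  finally show ?thesis .
qed

lemma riesz_mean_bounded:
  assumes "frequency lam" "0 \<le> l" "((\<lambda>x. riesz_mean lam l x D s) \<longlongrightarrow> L) at_top"
  shows "\<exists>B. \<forall>x. norm (riesz_mean lam l x D s) \<le> B"
proof -
  have "\<forall>\<^sub>F x in at_top. dist (riesz_mean lam l x D s) L < 1"
    using assms(3) by (rule tendstoD) auto
  then obtain X where X: "\<And>x. x \<ge> X \<Longrightarrow> dist (riesz_mean lam l x D s) L < 1"
    unfolding eventually_at_top_linorder by blast
  let ?S = "\<Sum>n | 1 \<le> n \<and> lam n \<le> X. norm (D n * exp (- of_real (lam n) * s))"
  have "norm (riesz_mean lam l x D s) \<le> max ?S (norm L + 1)" for x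
  proof (cases "x \<le> X")
    case True
    then show ?thesis using norm_riesz_mean_le[OF assms(1,2) True, of D s] by simp
  next
    case False
    then have "norm (riesz_mean lam l x D s - L) < 1"
      using X[of x] by (simp add: dist_norm)
    then show ?thesis
      using norm_triangle_ineq2[of "riesz_mean lam l x D s" L] by simp
  qed
  then show ?thesis by blast
qed

text \<open>
  The density for which the Riesz mean of order \<open>p\<close> at \<open>x\<close> is an average of the Riesz means of order \<open>l < p\<close> at
  \<open>x t\<close>, \<open>0 < t < 1\<close>, up to normalisation.
\<close>
definition beta_density :: "real \<Rightarrow> real \<Rightarrow> real \<Rightarrow> real" where
  "beta_density l p t = indicator {0..1} t * (t powr l * (1 - t) powr (p - l - 1))"

lemma beta_density_nonneg: "0 \<le> beta_density l p t"
  by (simp add: beta_density_def indicator_def)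

lemma borel_measurable_beta_density[measurable]: "beta_density l p \<in> borel_measurable borel"
  unfolding beta_density_def by measurable

lemma
  assumes "0 \<le> l" "l < p"
  shows integrable_beta_density: "integrable lborel (beta_density l p)"
    and beta_mass: "integral\<^sup>L lborel (beta_density l p) = Beta (l + 1) (p - l)"
proof -
  have i: "set_integrable lborel {0..1} (\<lambda>t. t powr l * (1 - t) powr (p - l - 1))"
    using integrable_Beta[of "l + 1" "p - l"] assms by simp
  then show "integrable lborel (beta_density l p)"
    by (simp add: set_integrable_def beta_density_def[abs_def])
  have "((\<lambda>t. t powr l * (1 - t) powr (p - l - 1)) has_integral Beta (l + 1) (p - l)) {0..1}"
    using has_integral_Beta_real[of "l + 1" "p - l"] assms by simp
  then show "integral\<^sup>L lborel (beta_density l p) = Beta (l + 1) (p - l)"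
    using set_borel_integral_eq_integral(2)[OF i]
    by (simp add: set_lebesgue_integral_def beta_density_def[abs_def] integral_unique)
qed

lemma beta_mass_pos:
  assumes "0 \<le> l" "l < p"
  shows "0 < integral\<^sup>L lborel (beta_density l p)"
  using assms by (simp add: beta_mass Beta_def Gamma_real_pos)

text \<open>
  With \<open>c = \<lambda>\<^sub>n / x\<close> the integrand is \<open>(t - c)\<^sup>l (1 - t) powr (p - l - 1)\<close> on \<open>[c, 1]\<close>, and \<open>t = c + (1 - c) \<tau>\<close>
  turns the integral into the total mass times \<open>(1 - c) powr p\<close>.
\<close>
lemma
  fixes lam :: "nat \<Rightarrow> real"
  assumes l: "0 \<le> l" "l < p" and x: "0 \<le> lam n" "lam n \<le> x" "0 < x"
  defines "g \<equiv> (\<lambda>t. beta_density l p t * (if lam n \<le> x * t then riesz_weight lam l (x * t) n else 0))"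
  shows riesz_weight_average_integrable: "integrable lborel g"
    and riesz_weight_average:
      "integral\<^sup>L lborel g = integral\<^sup>L lborel (beta_density l p) * riesz_weight lam p x n"
proof -
  have [measurable]: "(\<lambda>t. riesz_weight lam l (x * t) n) \<in> borel_measurable borel"
    unfolding riesz_weight_def by (cases "l = 0") auto
  have [measurable]: "g \<in> borel_measurable borel"
    unfolding g_def by measurable
  show "integrable lborel g"
  proof (rule Bochner_Integration.integrable_bound[OF integrable_beta_density[OF l]])
    show "AE t in lborel. norm (g t) \<le> norm (beta_density l p t)"
    proof (intro AE_I2)
      fix t
      have "\<bar>if lam n \<le> x * t then riesz_weight lam l (x * t) n else 0\<bar> \<le> 1"
        using riesz_weight_bounds[of lam n "x * t" l] x(1) l(1) by auto
      then have "\<bar>beta_density l p t\<bar> * \<bar>if lam n \<le> x * t then riesz_weight lam l (x * t) n else 0\<bar> \<le> \<bar>beta_density l p t\<bar> * 1"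
        by (intro mult_left_mono) auto
      then show "norm (g t) \<le> norm (beta_density l p t)"
        by (simp add: g_def abs_mult)
    qed
  qed auto
  define c where "c = lam n / x"
  have c: "0 \<le> c" "c \<le> 1"
    using x by (auto simp: c_def)
  let ?h = "\<lambda>t. indicator {c..1} t * ((t - c) powr l * (1 - t) powr (p - l - 1))"
  have AE: "AE t in lborel. g t = ?h t"
    using AE_lborel_singleton[of c]
  proof eventually_elim
    case (elim t)
    have le: "lam n \<le> x * t \<longleftrightarrow> c \<le> t"
      using x(3) by (simp add: c_def divide_le_eq mult.commute)
    show ?case
    proof (cases "c < t \<and> t \<le> 1")
      case True
      then have t: "0 < t" using c by linarith
      have "riesz_weight lam l (x * t) n * t powr l = (t - c) powr l"
      proof (cases "l = 0")
        case False
        have "1 - lam n / (x * t) = (t - c) / t"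
          using t x(3) by (simp add: c_def field_simps)
        then show ?thesis
          using False t True by (simp add: riesz_weight_def powr_divide)
      qed (use t True in \<open>auto simp: riesz_weight_def\<close>)
      moreover have "g t = (riesz_weight lam l (x * t) n * t powr l) * (1 - t) powr (p - l - 1)"
        using True t unfolding g_def le by (simp add: beta_density_def)
      moreover have "?h t = (t - c) powr l * (1 - t) powr (p - l - 1)"
        using True by simp
      ultimately show ?thesis by simp
    next
      case False
      then show ?thesis using elim c by (auto simp: g_def le beta_density_def indicator_def)
    qed
  qed
  have "integral\<^sup>L lborel g = integral\<^sup>L lborel ?h"
    by (rule integral_cong_AE) (use AE in auto)
  also have "\<dots> = integral\<^sup>L lborel (beta_density l p) * riesz_weight lam p x n"
  proof (cases "c = 1")
    case True
    have "AE t in lborel. ?h t = 0"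
      using AE_lborel_singleton[of c] by eventually_elim (auto simp: True indicator_def)
    then have "integral\<^sup>L lborel ?h = 0"
      by (subst integral_cong_AE[where g = "\<lambda>_. 0"]) auto
    moreover have "riesz_weight lam p x n = 0"
      using True l by (simp add: riesz_weight_def c_def)
    ultimately show ?thesis by simp
  next
    case False
    then have c1: "0 < 1 - c" using c by simp
    have "integral\<^sup>L lborel ?h = \<bar>1 - c\<bar> *\<^sub>R (LINT t|lborel. ?h (c + (1 - c) * t))"
      using c1 by (intro lborel_integral_real_affine) auto
    also have "(\<lambda>t. ?h (c + (1 - c) * t)) = (\<lambda>t. (1 - c) powr (p - 1) * beta_density l p t)"
    proof
      fix t
      have "c + (1 - c) * t \<le> 1 \<longleftrightarrow> (1 - c) * t \<le> (1 - c) * 1"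
        by (simp add: algebra_simps)
      also have "\<dots> \<longleftrightarrow> t \<le> 1"
        using c1 by (intro mult_le_cancel_left_pos)
      finally have "c + (1 - c) * t \<in> {c..1} \<longleftrightarrow> t \<in> {0..1}"
        using c1 by (auto simp: zero_le_mult_iff)
      moreover have "1 - (c + (1 - c) * t) = (1 - c) * (1 - t)"
        by (simp add: algebra_simps)
      moreover have "(1 - c) powr l * (1 - c) powr (p - l - 1) = (1 - c) powr (p - 1)"
        by (simp add: powr_add[symmetric])
      ultimately show "?h (c + (1 - c) * t) = (1 - c) powr (p - 1) * beta_density l p t"
        using c1 by (auto simp: beta_density_def indicator_def powr_mult mult_ac)
    qed
    also have "\<bar>1 - c\<bar> *\<^sub>R (LINT t|lborel. (1 - c) powr (p - 1) * beta_density l p t)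
       = ((1 - c) powr 1 * (1 - c) powr (p - 1)) * integral\<^sup>L lborel (beta_density l p)"
      using c1 by simp
    also have "(1 - c) powr 1 * (1 - c) powr (p - 1) = riesz_weight lam p x n"
      unfolding powr_add[symmetric] using l by (simp add: riesz_weight_def c_def)
    finally show ?thesis by simp
  qed
  finally show "integral\<^sup>L lborel g = integral\<^sup>L lborel (beta_density l p) * riesz_weight lam p x n" .
qed

lemma riesz_mean_average:
  assumes lam: "frequency lam" and l: "0 \<le> l" "l < p" and x: "0 < x"
  shows "(LINT t|lborel. of_real (beta_density l p t) * riesz_mean lam l (x * t) D s)
        = of_real (integral\<^sup>L lborel (beta_density l p)) * riesz_mean lam p x D s"
proof -
  let ?N = "{n. 1 \<le> n \<and> lam n \<le> x}"
  let ?g = "\<lambda>n t. beta_density l p t * (if lam n \<le> x * t then riesz_weight lam l (x * t) n else 0)"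
  have fin: "finite ?N"
    by (rule finite_frequency_le[OF lam])
  have eq: "of_real (beta_density l p t) * riesz_mean lam l (x * t) D s
    = (\<Sum>n\<in>?N. of_real (?g n t) * (D n * exp (- of_real (lam n) * s)))" for t
  proof (cases "0 \<le> t \<and> t \<le> 1")
    case True
    then have "{n. 1 \<le> n \<and> lam n \<le> x * t} = {n \<in> ?N. lam n \<le> x * t}"
      using x mult_left_le[of t x] by (auto intro: order_trans)
    then have "riesz_mean lam l (x * t) D s = (\<Sum>n\<in>?N. if lam n \<le> x * t then
        D n * of_real (riesz_weight lam l (x * t) n) * exp (- of_real (lam n) * s) else 0)"
      unfolding riesz_mean_def by (simp only: sum.inter_filter[OF fin])
    then show ?thesis
      by (auto simp: sum_distrib_left intro!: sum.cong)
  next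
    case False
    then have "beta_density l p t = 0" by (auto simp: beta_density_def)
    then show ?thesis by simp
  qed
  have i: "integrable lborel (?g n)"
    and v: "integral\<^sup>L lborel (?g n) = integral\<^sup>L lborel (beta_density l p) * riesz_weight lam p x n"
    if "n \<in> ?N" for n
    using riesz_weight_average_integrable[of l p lam n x] riesz_weight_average[of l p lam n x]
      that l x frequency_nonneg[OF lam] by auto
  have int: "integrable lborel (\<lambda>t. of_real (?g n t) * (D n * exp (- of_real (lam n) * s)))" if "n \<in> ?N" for n
    using integrable_of_real[OF i[OF that], where 'a=complex] by (rule integrable_mult_left)
  have "(LINT t|lborel. of_real (beta_density l p t) * riesz_mean lam l (x * t) D s)
     = (\<Sum>n\<in>?N. LINT t|lborel. of_real (?g n t) * (D n * exp (- of_real (lam n) * s)))"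
    unfolding eq using int by (rule Bochner_Integration.integral_sum)
  also have "\<dots> = (\<Sum>n\<in>?N. of_real (integral\<^sup>L lborel (?g n)) * (D n * exp (- of_real (lam n) * s)))"
    by (intro sum.cong refl, subst integral_mult_left_zero, subst integral_complex_of_real) simp
  also have "\<dots> = of_real (integral\<^sup>L lborel (beta_density l p)) * riesz_mean lam p x D s"
    unfolding riesz_mean_def sum_distrib_left by (intro sum.cong refl, subst v) auto
  finally show "(LINT t|lborel. of_real (beta_density l p t) * riesz_mean lam l (x * t) D s)
        = of_real (integral\<^sup>L lborel (beta_density l p)) * riesz_mean lam p x D s" .
qed

lemma borel_measurable_riesz_mean[measurable]:
  assumes lam: "frequency lam"
  shows "(\<lambda>x. riesz_mean lam l x D s) \<in> borel_measurable borel"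
proof (rule borel_measurable_LIMSEQ_metric)
  let ?f = "\<lambda>N x. \<Sum>n\<in>{1..N}. if lam n \<le> x
      then D n * of_real (riesz_weight lam l x n) * exp (- of_real (lam n) * s) else 0"
  have [measurable]: "(\<lambda>x. riesz_weight lam l x n) \<in> borel_measurable borel" for n
    unfolding riesz_weight_def by (cases "l = 0") auto
  show "?f N \<in> borel_measurable borel" for N
    by measurable
  show "(\<lambda>N. ?f N x) \<longlonglongrightarrow> riesz_mean lam l x D s" for x
  proof (rule tendsto_eventually)
    obtain N0 where N0: "\<And>n. n \<in> {n. 1 \<le> n \<and> lam n \<le> x} \<Longrightarrow> n \<le> N0"
      using finite_frequency_le[OF lam, of x] finite_nat_set_iff_bounded_le[of "{n. 1 \<le> n \<and> lam n \<le> x}"]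
      by blast
    show "\<forall>\<^sub>F N in sequentially. ?f N x = riesz_mean lam l x D s"
      using eventually_ge_at_top[of N0]
    proof eventually_elim
      case (elim N)
      have "{n. 1 \<le> n \<and> lam n \<le> x} = {n \<in> {1..N}. lam n \<le> x}"
        using N0 elim by (auto dest: order_trans)
      then show ?case
        unfolding riesz_mean_def by (simp only: sum.inter_filter[OF finite_atLeastAtMost])
    qed
  qed
qed

text \<open>
  Raising the order preserves the limit. It is used to pass to integer orders, for which
  integration by parts is available.
\<close>
lemma riesz_mean_consistency:
  assumes lam: "frequency lam" and l: "0 \<le> l" "l < p"
    and lim: "((\<lambda>x. riesz_mean lam l x D s) \<longlongrightarrow> L) at_top"
  shows "((\<lambda>x. riesz_mean lam p x D s) \<longlongrightarrow> L) at_top"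
proof -
  let ?\<beta> = "integral\<^sup>L lborel (beta_density l p)"
  obtain B where B: "\<And>x. norm (riesz_mean lam l x D s) \<le> B"
    using riesz_mean_bounded[OF lam l(1) lim] by blast
  have "((\<lambda>x. LINT t|lborel. of_real (beta_density l p t) * riesz_mean lam l (x * t) D s)
     \<longlongrightarrow> (LINT t|lborel. of_real (beta_density l p t) * L)) at_top"
  proof (rule integral_dominated_convergence_at_top)
    show "integrable lborel (\<lambda>t. beta_density l p t * B)"
      using integrable_beta_density[OF l] by auto
    show "\<forall>\<^sub>F x in at_top. AE t in lborel. norm (of_real (beta_density l p t) * riesz_mean lam l (x * t) D s)
         \<le> beta_density l p t * B"
      using B beta_density_nonneg by (intro always_eventually allI AE_I2) (auto simp: norm_mult intro!: mult_mono)
    show "AE t in lborel. ((\<lambda>x. of_real (beta_density l p t) * riesz_mean lam l (x * t) D s)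
       \<longlongrightarrow> of_real (beta_density l p t) * L) at_top"
    proof (intro AE_I2)
      fix t
      show "((\<lambda>x. of_real (beta_density l p t) * riesz_mean lam l (x * t) D s)
         \<longlongrightarrow> of_real (beta_density l p t) * L) at_top"
      proof (cases "t > 0")
        case True
        then have "filterlim (\<lambda>x. x * t) at_top at_top"
          by (intro filterlim_at_top_mult_tendsto_pos[OF tendsto_const _ filterlim_ident])
        from filterlim_compose[OF lim this] show ?thesis
          by (intro tendsto_intros) simp
      next
        case False
        then have "beta_density l p t = 0"
          by (cases "t = 0") (auto simp: beta_density_def)
        then show ?thesis by simp
      qed
    qed
    show "(\<lambda>t. of_real (beta_density l p t) * riesz_mean lam l (x * t) D s) \<in> borel_measurable lborel" for x
      using measurable_compose[OF _ borel_measurable_riesz_mean[OF lam], of "\<lambda>t. x * t" borel l D s]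
      by measurable
  qed measurable
  moreover have "(LINT t|lborel. of_real (beta_density l p t) * L) = of_real ?\<beta> * L"
    by (subst integral_mult_left_zero, subst integral_complex_of_real) simp
  moreover have "\<forall>\<^sub>F x in at_top. (LINT t|lborel. of_real (beta_density l p t) * riesz_mean lam l (x * t) D s)
      = of_real ?\<beta> * riesz_mean lam p x D s"
    using eventually_gt_at_top[of 0] by eventually_elim (rule riesz_mean_average[OF lam l])
  ultimately have "((\<lambda>x. of_real ?\<beta> * riesz_mean lam p x D s) \<longlongrightarrow> of_real ?\<beta> * L) at_top"
    using tendsto_cong by force
  then have "((\<lambda>x. (of_real ?\<beta> * riesz_mean lam p x D s) / of_real ?\<beta>) \<longlongrightarrow> (of_real ?\<beta> * L) / of_real ?\<beta>) at_top"
    using beta_mass_pos[OF l] by (intro tendsto_intros) auto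
  then show ?thesis
    using beta_mass_pos[OF l] by simp
qed

section \<open>Polynomial growth of Riesz means in a half-plane\<close>

text \<open>
  By Cauchy's formula for repeated integration this is the \<open>(i + 1)\<close>-fold iterated integral of
  \<open>(1 - v/x)\<^sup>c exp(- v z)\<close> between \<open>a\<close> and \<open>x\<close>. Integration by parts raises \<open>i\<close> and thereby replaces values at \<open>a\<close> by averages of \<open>(v - a)\<^sup>i\<close>, that is, by
  Riesz means of order \<open>i\<close>, at the price of one factor \<open>z\<close> or \<open>c/x\<close> per step.
\<close>
definition riesz_taylor :: "real \<Rightarrow> complex \<Rightarrow> nat \<Rightarrow> nat \<Rightarrow> real \<Rightarrow> complex" where
  "riesz_taylor x z i c a =
     (LINT v|lborel. indicator {a..x} v *\<^sub>R
        (of_real ((v - a) ^ i / fact i * (1 - v / x) ^ c) * exp (- of_real v * z)))"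

lemma continuous_on_riesz_taylor:
  fixes z :: complex
  shows "continuous_on S (\<lambda>v. of_real ((v - a) ^ i / fact i * (1 - v / x) ^ c) * exp (- of_real v * z))"
proof -
  have "continuous_on S (\<lambda>v. of_real (h v) * exp (- of_real v * z))" if "continuous_on S h" for h :: "real \<Rightarrow> real"
    using that by (intro continuous_intros)
  moreover have "continuous_on S (\<lambda>v. (v - a) ^ i / fact i * (1 - v / x) ^ c)"
    unfolding divide_inverse by (intro continuous_intros)
  ultimately show ?thesis .
qed

lemma riesz_taylor_integrable:
  fixes z :: complex
  shows "integrable lborel (\<lambda>v. indicator {a..x} v *\<^sub>R
     (of_real ((v - a) ^ i / fact i * (1 - v / x) ^ c) * exp (- of_real v * z)))"
  using borel_integrable_atLeastAtMost'[OF continuous_on_riesz_taylor, of a x a i x c z]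
  by (simp add: set_integrable_def)

lemma has_derivative_linear_power:
  fixes x :: real
  assumes "x \<noteq> 0"
  shows "((\<lambda>v. (1 - v / x) ^ Suc c) has_real_derivative (- (real (Suc c) / x) * (1 - v / x) ^ c)) (at v within S)"
proof -
  have "((\<lambda>v. 1 - v / x) has_real_derivative (- 1 / x)) (at v within S)"
    using assms by (auto intro!: derivative_eq_intros)
  moreover have "- (real (Suc c) / x) * (1 - v / x) ^ c = real (Suc c) * (- 1 / x * (1 - v / x) ^ (Suc c - Suc 0))"
    by simp
  ultimately show ?thesis
    using DERIV_power[of "\<lambda>v. 1 - v / x" "- 1 / x" v S "Suc c"] by (simp only:)
qed

lemma has_derivative_power_over_fact:
  "((\<lambda>v. (v - a) ^ Suc i / fact (Suc i)) has_real_derivative (v - a) ^ i / fact i) (at v within S)"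
proof -
  have "((\<lambda>v. v - a) has_real_derivative 1) (at v within S)"
    by (auto intro!: derivative_eq_intros)
  from DERIV_cdivide[OF DERIV_power[OF this, of "Suc i"], of "fact (Suc i)"] show ?thesis
    by (simp add: divide_simps)
qed

lemma has_vector_derivative_weighted_exp:
  fixes z :: complex
  assumes "(g has_real_derivative g') (at v within S)"
  shows "((\<lambda>v. of_real (g v) * exp (- of_real v * z)) has_vector_derivative
      (of_real g' * exp (- of_real v * z) - z * (of_real (g v) * exp (- of_real v * z)))) (at v within S)"
proof -
  have "((\<lambda>w. exp (- w * z)) has_field_derivative - z * exp (- of_real v * z)) (at (of_real v))"
    by (auto intro!: derivative_eq_intros)
  from has_vector_derivative_real_field[OF this]
  have "((\<lambda>v. exp (- of_real v * z)) has_vector_derivative - z * exp (- of_real v * z)) (at v within S)"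
    by simp
  moreover have "((\<lambda>v. of_real (g v) :: complex) has_vector_derivative of_real g') (at v within S)"
    using assms by (intro has_vector_derivative_of_real) (simp flip: has_real_derivative_iff_has_vector_derivative)
  ultimately show ?thesis
    using has_vector_derivative_mult[of "\<lambda>v. complex_of_real (g v)" "of_real g'" v S
        "\<lambda>v. exp (- of_real v * z)" "- z * exp (- of_real v * z)"]
    by (simp add: algebra_simps)
qed

text \<open>The boundary terms vanish: at \<open>a\<close> because of \<open>(v - a)\<^sup>i\<^sup>+\<^sup>1\<close>, at \<open>x\<close> because of \<open>(1 - v/x)\<^sup>c\<^sup>+\<^sup>1\<close>.\<close>
lemma riesz_taylor_step:
  assumes "a \<le> x" "x \<noteq> 0"
  shows "riesz_taylor x z i (Suc c) a
    = z * riesz_taylor x z (Suc i) (Suc c) a + of_real (real (Suc c) / x) * riesz_taylor x z (Suc i) c a"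
proof -
  let ?f = "\<lambda>i c v. of_real ((v - a) ^ i / fact i * (1 - v / x) ^ c) * exp (- of_real v * z)"
  let ?g = "\<lambda>v. ?f i (Suc c) v - (of_real (real (Suc c) / x) * ?f (Suc i) c v + z * ?f (Suc i) (Suc c) v)"
  have "(LINT v|lborel. indicator {a..x} v *\<^sub>R ?g v) = ?f (Suc i) (Suc c) x - ?f (Suc i) (Suc c) a"
  proof (rule integral_FTC_Icc)
    fix v assume "a \<le> v" "v \<le> x"
    have "((\<lambda>v. (v - a) ^ Suc i / fact (Suc i) * (1 - v / x) ^ Suc c) has_real_derivative
       ((v - a) ^ i / fact i * (1 - v / x) ^ Suc c
         - real (Suc c) / x * ((v - a) ^ Suc i / fact (Suc i) * (1 - v / x) ^ c))) (at v within {a..x})"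
      using DERIV_mult[OF has_derivative_power_over_fact[of a i v "{a..x}"]
          has_derivative_linear_power[OF assms(2), of c v "{a..x}"]]
      by (rule DERIV_cong) (simp only: mult_ac minus_mult_left[symmetric] minus_mult_right[symmetric] diff_conv_add_uminus add_ac)
    from has_vector_derivative_weighted_exp[OF this]
    show "(?f (Suc i) (Suc c) has_vector_derivative ?g v) (at v within {a..x})"
      by (simp add: algebra_simps)
  next
    show "continuous_on {a..x} ?g"
      by (intro continuous_on_diff continuous_on_add continuous_on_mult continuous_on_const continuous_on_riesz_taylor)
  qed (use assms in auto)
  also have "\<dots> = 0"
    using assms by simp
  finally have "0 = (LINT v|lborel. indicator {a..x} v *\<^sub>R ?f i (Suc c) v
      - (of_real (real (Suc c) / x) * (indicator {a..x} v *\<^sub>R ?f (Suc i) c v) + z * (indicator {a..x} v *\<^sub>R ?f (Suc i) (Suc c) v)))"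
    by (simp add: scaleR_conv_of_real algebra_simps)
  also have "\<dots> = riesz_taylor x z i (Suc c) a
     - (of_real (real (Suc c) / x) * riesz_taylor x z (Suc i) c a + z * riesz_taylor x z (Suc i) (Suc c) a)"
    unfolding riesz_taylor_def
    by (intro trans[OF Bochner_Integration.integral_diff] arg_cong2[where f="(-)"] refl
        trans[OF Bochner_Integration.integral_add] arg_cong2[where f="(+)"] integral_mult_right_zero
        Bochner_Integration.integrable_add integrable_mult_right riesz_taylor_integrable)
  finally show ?thesis by (simp add: algebra_simps)
qed

lemma riesz_taylor_base:
  assumes "a \<le> x" "x \<noteq> 0"
  shows "of_real ((1 - a / x) ^ Suc c) * exp (- of_real a * z)
    = z * riesz_taylor x z 0 (Suc c) a + of_real (real (Suc c) / x) * riesz_taylor x z 0 c a"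
proof -
  let ?f = "\<lambda>c v. of_real ((v - a) ^ 0 / fact 0 * (1 - v / x) ^ c) * exp (- of_real v * z)"
  let ?g = "\<lambda>v. of_real (- (real (Suc c) / x)) * ?f c v - z * ?f (Suc c) v"
  have "(LINT v|lborel. indicator {a..x} v *\<^sub>R ?g v) = ?f (Suc c) x - ?f (Suc c) a"
  proof (rule integral_FTC_Icc)
    fix v assume "a \<le> v" "v \<le> x"
    have "((\<lambda>v. (v - a) ^ 0 / fact 0 * (1 - v / x) ^ Suc c) has_real_derivative
         (- (real (Suc c) / x) * ((v - a) ^ 0 / fact 0 * (1 - v / x) ^ c))) (at v within {a..x})"
      using has_derivative_linear_power[OF assms(2), of c v "{a..x}"] by simp
    from has_vector_derivative_weighted_exp[OF this]
    show "(?f (Suc c) has_vector_derivative ?g v) (at v within {a..x})"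
      by (simp add: algebra_simps)
  next
    show "continuous_on {a..x} ?g"
      by (intro continuous_on_diff continuous_on_add continuous_on_mult continuous_on_const continuous_on_riesz_taylor)
  qed (use assms in auto)
  also have "\<dots> = - (of_real ((1 - a / x) ^ Suc c) * exp (- of_real a * z))"
    using assms by simp
  finally have "- (of_real ((1 - a / x) ^ Suc c) * exp (- of_real a * z))
    = (LINT v|lborel. of_real (- (real (Suc c) / x)) * (indicator {a..x} v *\<^sub>R ?f c v) - z * (indicator {a..x} v *\<^sub>R ?f (Suc c) v))"
    by (simp add: scaleR_conv_of_real algebra_simps)
  also have "\<dots> = of_real (- (real (Suc c) / x)) * riesz_taylor x z 0 c a - z * riesz_taylor x z 0 (Suc c) a"
    unfolding riesz_taylor_def
    by (intro trans[OF Bochner_Integration.integral_diff] arg_cong2[where f="(-)"] refl integral_mult_right_zero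
        integrable_mult_right riesz_taylor_integrable)
  finally have "- (of_real ((1 - a / x) ^ Suc c) * exp (- of_real a * z))
    = - (z * riesz_taylor x z 0 (Suc c) a + of_real (real (Suc c) / x) * riesz_taylor x z 0 c a)"
    by (simp only: of_real_minus mult_minus_left minus_add_distrib diff_conv_add_uminus add.commute)
  then show ?thesis by (simp only: neg_equal_iff_equal)
qed

lemma riesz_mean_nat:
  assumes "p > 0" and "frequency lam" "x > 0"
  shows "riesz_mean lam (real p) x D s =
    (\<Sum>n | 1 \<le> n \<and> lam n \<le> x. D n * of_real ((1 - lam n / x) ^ p) * exp (- of_real (lam n) * s))"
  unfolding riesz_mean_def
proof (intro sum.cong refl arg_cong2[where f="(*)"] arg_cong[where f=of_real])
  fix n assume "n \<in> {n. 1 \<le> n \<and> lam n \<le> x}"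
  then have "0 \<le> 1 - lam n / x"
    using assms by (simp add: divide_le_eq_1)
  then show "riesz_weight lam (real p) x n = (1 - lam n / x) ^ p"
    using assms by (cases "1 - lam n / x = 0") (auto simp: riesz_weight_def powr_realpow)
qed

text \<open>
  Summed against the coefficients, \<open>(v - \<lambda>\<^sub>n)\<^sup>L\<close> becomes \<open>v\<^sup>L\<close> times the Riesz mean of order \<open>L\<close> at \<open>v\<close>, and
  the integral of \<open>v\<^sup>L exp(- v) / L!\<close> is \<open>1\<close>.
\<close>
lemma riesz_taylor_sum_le:
  assumes lam: "frequency lam" and L: "L > 0" and x: "x > 0" and z: "Re z \<ge> 1"
    and B: "\<And>v. norm (riesz_mean lam (real L) v D s) \<le> B"
  shows "norm (\<Sum>n | 1 \<le> n \<and> lam n \<le> x. (D n * exp (- of_real (lam n) * s)) * riesz_taylor x z L c (lam n)) \<le> B"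
proof -
  let ?N = "{n. 1 \<le> n \<and> lam n \<le> x}"
  let ?b = "\<lambda>n. D n * exp (- of_real (lam n) * s)"
  let ?f = "\<lambda>a v. indicator {a..x} v *\<^sub>R (of_real ((v - a) ^ L / fact L * (1 - v / x) ^ c) * exp (- of_real v * z))"
  let ?w = "\<lambda>v::real. B * (1 / fact L * (v ^ L * exp (- v) * indicator {0..} v))"
  have fin: "finite ?N" by (rule finite_frequency_le[OF lam])
  have B0: "0 \<le> B" using B[of 0] norm_ge_zero order_trans by blast
  have hw: "has_bochner_integral lborel ?w (B * (1 / fact L * fact L))"
    by (intro has_bochner_integral_mult_right has_bochner_integral_I0i_power_exp_m')
  have eq: "(\<Sum>n\<in>?N. ?b n * riesz_taylor x z L c (lam n)) = (LINT v|lborel. (\<Sum>n\<in>?N. ?b n * ?f (lam n) v))"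
    unfolding riesz_taylor_def
    by (subst Bochner_Integration.integral_sum)
      (intro integrable_mult_right riesz_taylor_integrable, intro sum.cong refl integral_mult_right_zero[symmetric])
  have "norm (LINT v|lborel. (\<Sum>n\<in>?N. ?b n * ?f (lam n) v)) \<le> integral\<^sup>L lborel ?w"
  proof (rule Bochner_Integration.integral_norm_bound_integral)
    show "integrable lborel (\<lambda>v. \<Sum>n\<in>?N. ?b n * ?f (lam n) v)"
      by (intro Bochner_Integration.integrable_sum integrable_mult_right riesz_taylor_integrable)
    show "integrable lborel ?w" using hw by (rule integrable.intros)
    show "norm (\<Sum>n\<in>?N. ?b n * ?f (lam n) v) \<le> ?w v" for v
    proof (cases "0 < v \<and> v \<le> x")
      case True
      have "{n. 1 \<le> n \<and> lam n \<le> v} = {n \<in> ?N. lam n \<le> v}"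
        using True by auto
      then have "riesz_mean lam (real L) v D s =
         (\<Sum>n\<in>?N. if lam n \<le> v then D n * of_real ((1 - lam n / v) ^ L) * exp (- of_real (lam n) * s) else 0)"
        using riesz_mean_nat[OF L lam, of v D s] True by (simp only: sum.inter_filter[OF fin])
      then have "of_real (v ^ L / fact L * (1 - v / x) ^ c) * exp (- of_real v * z) * riesz_mean lam (real L) v D s
         = (\<Sum>n\<in>?N. ?b n * ?f (lam n) v)"
      proof (simp only: sum_distrib_left, intro sum.cong refl)
        fix n assume "n \<in> ?N"
        show "of_real (v ^ L / fact L * (1 - v / x) ^ c) * exp (- of_real v * z) *
           (if lam n \<le> v then D n * of_real ((1 - lam n / v) ^ L) * exp (- of_real (lam n) * s) else 0)
           = ?b n * ?f (lam n) v"
        proof (cases "lam n \<le> v")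
          case le: True
          have "v ^ L * (1 - lam n / v) ^ L = (v - lam n) ^ L"
            using True by (simp add: power_mult_distrib[symmetric] field_simps)
          then have eq: "complex_of_real v ^ L * of_real ((1 - lam n / v) ^ L) = of_real ((v - lam n) ^ L)"
            by (metis of_real_mult of_real_power)
          have "of_real (v ^ L / fact L * (1 - v / x) ^ c) * exp (- of_real v * z) *
             (D n * of_real ((1 - lam n / v) ^ L) * exp (- of_real (lam n) * s))
             = ?b n * (of_real v ^ L * of_real ((1 - lam n / v) ^ L)) * (of_real (1 / fact L * (1 - v / x) ^ c) * exp (- of_real v * z))"
            by (simp add: mult_ac)
          also have "\<dots> = ?b n * ?f (lam n) v"
            unfolding eq using le True by (simp add: mult_ac)
          finally show ?thesis using le by simp
        qed simp
      qed
      then have "norm (\<Sum>n\<in>?N. ?b n * ?f (lam n) v)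
         = norm (of_real (v ^ L / fact L * (1 - v / x) ^ c) * exp (- of_real v * z) * riesz_mean lam (real L) v D s)"
        by simp
      also have "\<dots> = v ^ L / fact L * (1 - v / x) ^ c * exp (- v * Re z) * norm (riesz_mean lam (real L) v D s)"
      proof -
        have "0 \<le> v ^ L / fact L * (1 - v / x) ^ c"
          using True by (auto intro!: mult_nonneg_nonneg simp: divide_le_eq_1)
        then show ?thesis
          by (simp only: norm_mult norm_of_real abs_of_nonneg norm_exp_eq_Re Re_complex_of_real uminus_complex.sel times_complex.sel Im_complex_of_real) simp
      qed
      also have "\<dots> \<le> v ^ L / fact L * 1 * exp (- v) * B"
        using True z B x by (intro mult_mono power_le_one mult_nonneg_nonneg divide_nonneg_nonneg) (auto simp: divide_le_eq_1)
      also have "\<dots> = ?w v" using True by simp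
      finally show ?thesis .
    next
      case False
      have "?f (lam n) v = 0" if "n \<in> ?N" for n
        using False L frequency_nonneg[OF lam, of n] that
        by (cases "v = 0") (auto simp: indicator_def)
      then have "(\<Sum>n\<in>?N. ?b n * ?f (lam n) v) = 0"
        by (intro sum.neutral) auto
      then show ?thesis
        using B0 by (auto simp: indicator_def)
    qed
  qed
  also have "\<dots> = B"
    by (rule trans[OF has_bochner_integral_integral_eq[OF hw]]) simp
  finally show ?thesis unfolding eq .
qed

text \<open>
  Boundedness of the means of order \<open>L\<close> at one point gives polynomial growth of the means of order \<open>L + 1\<close>
  at least one unit to its right, uniformly in \<open>x\<close>: integrate by parts \<open>L + 1\<close> times. The extra order makes every boundary term at \<open>x\<close> vanish.
\<close>
lemma riesz_mean_growth:
  assumes lam: "frequency lam" and L: "L > 0" and x: "x \<ge> 1" and z: "Re z \<ge> 1"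
    and B: "\<And>v. norm (riesz_mean lam (real L) v D s) \<le> B"
  shows "norm (riesz_mean lam (real (Suc L)) x D (s + z)) \<le> (norm z + real (Suc L)) ^ Suc L * B"
proof -
  let ?N = "{n. 1 \<le> n \<and> lam n \<le> x}"
  let ?b = "\<lambda>n. D n * exp (- of_real (lam n) * s)"
  let ?K = "norm z + real (Suc L)"
  define T where "T i c = (\<Sum>n\<in>?N. ?b n * riesz_taylor x z i c (lam n))" for i c
  have x0: "x > 0" using x by simp
  have B0: "0 \<le> B" using B[of 0] norm_ge_zero order_trans by blast
  have step_bound: "norm (z * S + of_real (real (Suc c) / x) * S') \<le> ?K * M"
    if "norm S \<le> M" "norm S' \<le> M" "Suc c \<le> Suc L" for S S' :: complex and M c
  proof -
    have "0 \<le> M" using that(1) norm_ge_zero order_trans by blast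
    have "real (Suc c) / x \<le> real (Suc c) / 1"
      using x by (intro divide_left_mono) auto
    also have "\<dots> \<le> real (Suc L)" using that(3) by simp
    finally have c: "real (Suc c) / x \<le> real (Suc L)" .
    have "norm (z * S + of_real (real (Suc c) / x) * S') \<le> norm z * norm S + real (Suc c) / x * norm S'"
      using x0 by (intro order_trans[OF norm_triangle_ineq]) (simp add: norm_mult norm_divide del: of_nat_Suc)
    also have "\<dots> \<le> norm z * M + real (Suc L) * M"
      using that c \<open>0 \<le> M\<close> by (intro add_mono mult_mono) auto
    finally show ?thesis by (simp add: algebra_simps)
  qed
  \<comment> \<open>Each step raises \<open>i\<close> by one and keeps or lowers the exponent of \<open>1 - v/x\<close>, so \<open>d = L - i\<close> steps need an exponent of at least \<open>d\<close>.\<close>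
  have main: "norm (T i (c + d)) \<le> ?K ^ d * B" if "i + d = L" "c + d \<le> Suc L" for i c d
    using that
  proof (induction d arbitrary: i c)
    case 0
    then show ?case
      using riesz_taylor_sum_le[OF lam L x0 z B] by (simp add: T_def)
  next
    case (Suc d)
    have "T i (Suc (c + d)) = z * T (Suc i) (Suc (c + d)) + of_real (real (Suc (c + d)) / x) * T (Suc i) (c + d)"
    proof -
      have "T i (Suc (c + d)) = (\<Sum>n\<in>?N. ?b n * (z * riesz_taylor x z (Suc i) (Suc (c + d)) (lam n)
         + of_real (real (Suc (c + d)) / x) * riesz_taylor x z (Suc i) (c + d) (lam n)))"
        unfolding T_def using x0 by (intro sum.cong refl, subst riesz_taylor_step) auto
      also have "\<dots> = z * T (Suc i) (Suc (c + d)) + of_real (real (Suc (c + d)) / x) * T (Suc i) (c + d)"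
        unfolding T_def sum_distrib_left by (simp add: sum.distrib[symmetric] algebra_simps)
      finally show ?thesis .
    qed
    also have "norm \<dots> \<le> ?K * (?K ^ d * B)"
    proof (rule step_bound)
      show "norm (T (Suc i) (Suc (c + d))) \<le> ?K ^ d * B"
        using Suc.IH[of "Suc i" "Suc c"] Suc.prems by simp
      show "norm (T (Suc i) (c + d)) \<le> ?K ^ d * B"
        using Suc.IH[of "Suc i" c] Suc.prems by simp
    qed (use Suc.prems in simp)
    finally show ?case by (simp add: mult.assoc)
  qed
  have "riesz_mean lam (real (Suc L)) x D (s + z)
    = (\<Sum>n\<in>?N. ?b n * (of_real ((1 - lam n / x) ^ Suc L) * exp (- of_real (lam n) * z)))"
    unfolding riesz_mean_nat[OF zero_less_Suc lam x0]
  proof (intro sum.cong refl)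
    fix n
    have "exp (- complex_of_real (lam n) * (s + z)) = exp (- of_real (lam n) * s) * exp (- of_real (lam n) * z)"
      by (simp add: distrib_left mult_exp_exp)
    then show "D n * of_real ((1 - lam n / x) ^ Suc L) * exp (- of_real (lam n) * (s + z))
      = ?b n * (of_real ((1 - lam n / x) ^ Suc L) * exp (- of_real (lam n) * z))"
      by (simp only: mult_ac)
  qed
  also have "\<dots> = (\<Sum>n\<in>?N. ?b n * (z * riesz_taylor x z 0 (Suc L) (lam n)
       + of_real (real (Suc L) / x) * riesz_taylor x z 0 L (lam n)))"
    using x0 by (intro sum.cong refl, subst riesz_taylor_base) auto
  also have "\<dots> = z * T 0 (Suc L) + of_real (real (Suc L) / x) * T 0 L"
    unfolding T_def sum_distrib_left by (simp add: sum.distrib[symmetric] algebra_simps)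
  also have "norm \<dots> \<le> ?K * (?K ^ L * B)"
    using main[of 0 L 1] main[of 0 L 0] by (intro step_bound) auto
  finally show ?thesis by (simp add: mult.assoc)
qed

section \<open>Multipliers acting on the limit function\<close>

lemma riesz_weight_tendsto_1:
  assumes "0 \<le> l"
  shows "((\<lambda>x. riesz_weight lam l x n) \<longlongrightarrow> 1) at_top"
proof (cases "l = 0")
  case False
  have "((\<lambda>x. (1 - lam n / x) powr l) \<longlongrightarrow> (1 - 0) powr l) at_top"
    by (intro tendsto_intros tendsto_divide_0[OF tendsto_const] filterlim_at_top_imp_at_infinity filterlim_ident) auto
  then show ?thesis using False by (simp add: riesz_weight_def)
qed (simp add: riesz_weight_def)

lemma exp_shift_eq_cis:
  "exp (- of_real a * (s - \<i> * of_real t)) = exp (- of_real a * s) * cis (a * t)"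
  by (simp add: cis_conv_exp mult_exp_exp algebra_simps)

lemma fourier_riesz_mean:
  assumes "integrable lborel \<kappa>"
  shows "(LINT t|lborel. \<kappa> t * riesz_mean lam l x D (s - \<i> * of_real t))
    = (\<Sum>n | 1 \<le> n \<and> lam n \<le> x. D n * of_real (riesz_weight lam l x n) * exp (- of_real (lam n) * s) * fourier \<kappa> (lam n))"
proof -
  have eq: "\<kappa> t * riesz_mean lam l x D (s - \<i> * of_real t)
    = (\<Sum>n | 1 \<le> n \<and> lam n \<le> x. (D n * of_real (riesz_weight lam l x n) * exp (- of_real (lam n) * s)) * (\<kappa> t * cis (lam n * t)))" for t
    unfolding riesz_mean_def sum_distrib_left exp_shift_eq_cis by (intro sum.cong refl) (simp only: mult_ac)
  have int: "integrable lborel (\<lambda>t. \<kappa> t * cis (u * t))" for u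
    by (rule integrable_mult_bounded[OF assms, where B=1]) auto
  show ?thesis
    unfolding eq fourier_def
    by (subst Bochner_Integration.integral_sum) (intro integrable_mult_right int, intro sum.cong refl integral_mult_right_zero)
qed

lemma continuous_on_riesz_mean_vertical:
  "continuous_on UNIV (\<lambda>t. riesz_mean lam l x D (s - \<i> * of_real t))"
  unfolding riesz_mean_def by (intro continuous_intros)

lemma continuous_on_vertical:
  assumes "f holomorphic_on {s. 0 < Re s}" "0 < Re s"
  shows "continuous_on UNIV (\<lambda>t. f (s - \<i> * of_real t))"
  by (rule continuous_on_compose2[OF holomorphic_on_imp_continuous_on[OF assms(1)]])
     (use assms(2) in \<open>auto intro!: continuous_intros\<close>)

text \<open>
  For a finite Riesz mean the identity is a finite sum of Fourier integrals. Since the means of order \<open>L + 1\<close> grow like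
  \<open>(1 + \<bar>t\<bar>)\<^sup>L\<^sup>+\<^sup>1\<close> uniformly in \<open>x\<close>, dominated convergence yields it for \<open>f\<close>. The decay required of \<open>\<kappa>\<close> depends on
  the order of summability of the series, hence the existential \<open>N\<close>.
\<close>
lemma multiplier_identity_smooth:
  assumes lam: "frequency lam" and ext: "extends_riesz_limit lam D f"
  shows "\<exists>(\<sigma>::real) (N::nat). \<forall>\<kappa> U s. \<kappa> \<in> borel_measurable borel \<longrightarrow>
       integrable lborel (\<lambda>t. norm (\<kappa> t) * (1 + \<bar>t\<bar>) ^ N) \<longrightarrow>
       (\<forall>u\<ge>U. fourier \<kappa> u = 0) \<longrightarrow> \<sigma> < Re s \<longrightarrow>
       (LINT t|lborel. \<kappa> t * f (s - \<i> * of_real t))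
         = (\<Sum>n | 1 \<le> n \<and> lam n \<le> U. D n * fourier \<kappa> (lam n) * exp (- of_real (lam n) * s))"
proof -
  obtain l where hol: "f holomorphic_on {s. 0 < Re s}" and l: "0 \<le> l" and abs: "riesz_abscissa lam l D < \<infinity>"
    and lim: "\<And>s. 0 < Re s \<Longrightarrow> riesz_abscissa lam l D < ereal (Re s) \<Longrightarrow>
           ((\<lambda>x. riesz_mean lam l x D s) \<longlongrightarrow> f s) at_top"
    using ext unfolding extends_riesz_limit_def by blast
  obtain r where r: "riesz_abscissa lam l D < ereal r"
    using less_PInf_Ex_of_nat abs by auto
  define s0 where "s0 = complex_of_real (max r 1)"
  \<comment> \<open>An integer order above \<open>l\<close>; the means of this order are bounded at \<open>s0\<close> by consistency.\<close>
  define L where "L = Suc (nat \<lceil>l\<rceil>)"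
  have L: "0 < L" "l < real L"
    unfolding L_def by (simp, linarith)
  have lim': "((\<lambda>x. riesz_mean lam l x D s) \<longlongrightarrow> f s) at_top" if "Re s0 \<le> Re s" for s
    by (rule lim) (use that r in \<open>auto simp: s0_def intro: less_le_trans\<close>)
  obtain B where B: "\<And>x. norm (riesz_mean lam (real L) x D s0) \<le> B"
    using riesz_mean_bounded[OF lam _ riesz_mean_consistency[OF lam l L(2) lim'[OF order_refl]]] by auto
  have B0: "0 \<le> B" using B[of 0] norm_ge_zero order_trans by blast
  show ?thesis
  proof (intro exI allI impI)
    fix \<kappa> :: "real \<Rightarrow> complex" and U :: real and s :: complex
    assume m[measurable]: "\<kappa> \<in> borel_measurable borel"
      and int: "integrable lborel (\<lambda>t. norm (\<kappa> t) * (1 + \<bar>t\<bar>) ^ Suc L)"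
      and "\<forall>u\<ge>U. fourier \<kappa> u = 0" and s: "Re s0 + 1 < Re s"
    then have U: "\<And>u. U \<le> u \<Longrightarrow> fourier \<kappa> u = 0" by blast
    have s0: "0 < Re s0" by (simp add: s0_def)
    have i\<kappa>: "integrable lborel \<kappa>"
      by (rule integrable_weighted[OF m int]) (auto intro: one_le_power simp del: power_Suc)
    let ?R = "\<lambda>x s. riesz_mean lam (real (Suc L)) x D s"
    have conv: "((\<lambda>x. ?R x s') \<longlongrightarrow> f s') at_top" if "Re s0 \<le> Re s'" for s'
      using L(2) by (intro riesz_mean_consistency[OF lam l _ lim'[OF that]]) simp
    have "((\<lambda>x. LINT t|lborel. \<kappa> t * ?R x (s - \<i> * of_real t)) \<longlongrightarrow> (LINT t|lborel. \<kappa> t * f (s - \<i> * of_real t))) at_top"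
    proof (rule integral_dominated_convergence_at_top)
      let ?c = "(norm (s - s0) + real (Suc L)) ^ Suc L * B"
      show "integrable lborel (\<lambda>t. ?c * (norm (\<kappa> t) * (1 + \<bar>t\<bar>) ^ Suc L))"
        using int by (rule integrable_mult_right)
      show "AE t in lborel. ((\<lambda>x. \<kappa> t * ?R x (s - \<i> * of_real t)) \<longlongrightarrow> \<kappa> t * f (s - \<i> * of_real t)) at_top"
        using s by (intro AE_I2 tendsto_intros conv) auto
      show "\<forall>\<^sub>F x in at_top. AE t in lborel. norm (\<kappa> t * ?R x (s - \<i> * of_real t))
          \<le> ?c * (norm (\<kappa> t) * (1 + \<bar>t\<bar>) ^ Suc L)"
        using eventually_ge_at_top[of 1]
      proof eventually_elim
        case (elim x)
        show ?case
        proof (intro AE_I2)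
          fix t :: real
          let ?z = "s - \<i> * of_real t - s0"
          have nz: "norm ?z \<le> norm (s - s0) + \<bar>t\<bar>"
            using norm_triangle_ineq4[of "s - s0" "\<i> * of_real t"] by (simp add: norm_mult algebra_simps)
          have "norm ?z + real (Suc L) \<le> (norm (s - s0) + real (Suc L)) * (1 + \<bar>t\<bar>)"
          proof -
            have "1 * \<bar>t\<bar> \<le> (norm (s - s0) + real (Suc L)) * \<bar>t\<bar>"
              by (intro mult_right_mono) auto
            then show ?thesis using nz by (simp add: distrib_left)
          qed
          then have "(norm ?z + real (Suc L)) ^ Suc L \<le> ((norm (s - s0) + real (Suc L)) * (1 + \<bar>t\<bar>)) ^ Suc L"
            by (intro power_mono) auto
          then have "(norm ?z + real (Suc L)) ^ Suc L * B \<le> ((norm (s - s0) + real (Suc L)) ^ Suc L * (1 + \<bar>t\<bar>) ^ Suc L) * B"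
            using B0 unfolding power_mult_distrib by (rule mult_right_mono)
          moreover have "norm (?R x (s0 + ?z)) \<le> (norm ?z + real (Suc L)) ^ Suc L * B"
            using s by (intro riesz_mean_growth[OF lam L(1) elim _ B]) auto
          ultimately have "norm (?R x (s - \<i> * of_real t)) \<le> (norm (s - s0) + real (Suc L)) ^ Suc L * (1 + \<bar>t\<bar>) ^ Suc L * B"
            by simp
          from mult_left_mono[OF this norm_ge_zero[of "\<kappa> t"]]
          show "norm (\<kappa> t * ?R x (s - \<i> * of_real t)) \<le> ?c * (norm (\<kappa> t) * (1 + \<bar>t\<bar>) ^ Suc L)"
            by (simp only: norm_mult mult_ac)
        qed
      qed
      have "(\<lambda>t. f (s - \<i> * of_real t)) \<in> borel_measurable borel"
        using s s0 by (intro borel_measurable_continuous_onI continuous_on_vertical[OF hol]) auto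
      then show "(\<lambda>t. \<kappa> t * f (s - \<i> * of_real t)) \<in> borel_measurable lborel"
        by measurable
      have "(\<lambda>t. ?R x (s - \<i> * of_real t)) \<in> borel_measurable borel" for x
        by (intro borel_measurable_continuous_onI continuous_on_riesz_mean_vertical)
      then show "(\<lambda>t. \<kappa> t * ?R x (s - \<i> * of_real t)) \<in> borel_measurable lborel" for x
        by measurable
    qed
    moreover have "((\<lambda>x. LINT t|lborel. \<kappa> t * ?R x (s - \<i> * of_real t))
      \<longlongrightarrow> (\<Sum>n | 1 \<le> n \<and> lam n \<le> U. D n * of_real 1 * exp (- of_real (lam n) * s) * fourier \<kappa> (lam n))) at_top"
    proof (rule Lim_transform_eventually)
      show "((\<lambda>x. \<Sum>n | 1 \<le> n \<and> lam n \<le> U. D n * of_real (riesz_weight lam (real (Suc L)) x n) * exp (- of_real (lam n) * s) * fourier \<kappa> (lam n))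
        \<longlongrightarrow> (\<Sum>n | 1 \<le> n \<and> lam n \<le> U. D n * of_real 1 * exp (- of_real (lam n) * s) * fourier \<kappa> (lam n))) at_top"
        by (intro tendsto_intros riesz_weight_tendsto_1) auto
      show "\<forall>\<^sub>F x in at_top. (\<Sum>n | 1 \<le> n \<and> lam n \<le> U. D n * of_real (riesz_weight lam (real (Suc L)) x n) * exp (- of_real (lam n) * s) * fourier \<kappa> (lam n))
         = (LINT t|lborel. \<kappa> t * ?R x (s - \<i> * of_real t))"
        using eventually_ge_at_top[of U]
      proof eventually_elim
        case (elim x)
        show ?case
          unfolding fourier_riesz_mean[OF i\<kappa>]
        proof (rule sum.mono_neutral_left)
          have "fourier \<kappa> (lam i) = 0" if "\<not> lam i \<le> U" for i
            using that by (intro U) simp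
          then show "\<forall>i\<in>{n. 1 \<le> n \<and> lam n \<le> x} - {n. 1 \<le> n \<and> lam n \<le> U}.
              D i * of_real (riesz_weight lam (real (Suc L)) x i) * exp (- of_real (lam i) * s) * fourier \<kappa> (lam i) = 0"
            by auto
        qed (use elim finite_frequency_le[OF lam] in auto)
      qed
    qed
    ultimately have "(LINT t|lborel. \<kappa> t * f (s - \<i> * of_real t))
       = (\<Sum>n | 1 \<le> n \<and> lam n \<le> U. D n * of_real 1 * exp (- of_real (lam n) * s) * fourier \<kappa> (lam n))"
      by (rule tendsto_unique[rotated]) simp
    then show "(LINT t|lborel. \<kappa> t * f (s - \<i> * of_real t))
         = (\<Sum>n | 1 \<le> n \<and> lam n \<le> U. D n * fourier \<kappa> (lam n) * exp (- of_real (lam n) * s))"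
      by (simp add: mult_ac)
  qed
qed

lemma vertical_weight_le:
  assumes "0 \<le> k"
  shows "(1 + norm (s - \<i> * of_real t)) powr k \<le> (1 + norm s) powr k * (1 + \<bar>t\<bar>) powr k"
proof -
  have "norm (s - \<i> * of_real t) \<le> norm s + \<bar>t\<bar>"
    using norm_triangle_ineq4[of s "\<i> * of_real t"] by (simp add: norm_mult)
  then have "1 + norm (s - \<i> * of_real t) \<le> (1 + norm s) * (1 + \<bar>t\<bar>)"
    by (simp add: distrib_left distrib_right) (smt (verit) abs_ge_zero mult_nonneg_nonneg norm_ge_zero)
  then have "(1 + norm (s - \<i> * of_real t)) powr k \<le> ((1 + norm s) * (1 + \<bar>t\<bar>)) powr k"
    using assms by (intro powr_mono2) auto
  then show ?thesis by (simp add: powr_mult)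
qed

lemma powr_le_power:
  assumes "k \<le> real M" "1 \<le> y"
  shows "y powr k \<le> y ^ M"
  using powr_mono[OF assms] assms(2) by (simp add: powr_realpow)

text \<open>
  The integer \<open>M \<ge> k\<close> is there for the kernels: averaging, which produces the bump, improves their decay by whole
  orders, so their natural weight is \<open>(1 + \<bar>t\<bar>)\<^sup>M\<close>.
\<close>
locale half_plane_growth =
  fixes f :: "complex \<Rightarrow> complex" and B k :: real and M :: nat
  assumes hol: "f holomorphic_on {s. 0 < Re s}"
    and k: "0 \<le> k" "k \<le> real M"
    and growth: "\<And>s. 0 < Re s \<Longrightarrow> norm (f s) \<le> B * (1 + norm s) powr k"
begin

lemma B_nonneg: "0 \<le> B"
proof -
  have "0 \<le> B * (1 + norm (1::complex)) powr k"
    using growth[of 1] norm_ge_zero[of "f 1"] by (simp del: norm_ge_zero)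
  then show ?thesis by (simp add: zero_le_mult_iff)
qed

lemma growth_vertical:
  assumes "0 < Re s"
  shows "norm (f (s - \<i> * of_real t)) \<le> B * (1 + norm s) powr k * (1 + \<bar>t\<bar>) powr k"
proof -
  have "norm (f (s - \<i> * of_real t)) \<le> B * (1 + norm (s - \<i> * of_real t)) powr k"
    using assms by (intro growth) simp
  also have "\<dots> \<le> B * ((1 + norm s) powr k * (1 + \<bar>t\<bar>) powr k)"
    using B_nonneg vertical_weight_le[OF k(1)] by (rule mult_left_mono[rotated])
  finally show ?thesis by (simp add: mult.assoc)
qed

lemma growth_vertical_power:
  assumes "0 < Re s"
  shows "norm (f (s - \<i> * of_real t)) \<le> B * (1 + norm s) powr k * (1 + \<bar>t\<bar>) ^ M"
proof (rule order_trans[OF growth_vertical[OF assms] mult_left_mono])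
  show "(1 + \<bar>t\<bar>) powr k \<le> (1 + \<bar>t\<bar>) ^ M"
    by (rule powr_le_power[OF k(2)]) simp
qed (use B_nonneg in auto)

lemma measurable_vertical: "0 < Re s \<Longrightarrow> (\<lambda>t. f (s - \<i> * of_real t)) \<in> borel_measurable borel"
  by (intro borel_measurable_continuous_onI continuous_on_vertical[OF hol])

context
  fixes \<kappa> :: "real \<Rightarrow> complex"
  assumes cont: "continuous_on UNIV \<kappa>"
    and int: "integrable lborel (\<lambda>t. norm (\<kappa> t) * (1 + \<bar>t\<bar>) ^ M)"
begin

lemma kernel_measurable[measurable]: "\<kappa> \<in> borel_measurable borel"
  using cont by (rule borel_measurable_continuous_onI)

lemma kernel_integrable: "integrable lborel \<kappa>"
  by (rule integrable_weighted[OF kernel_measurable int]) (auto intro: one_le_power)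

lemma norm_vertical_convolution_le:
  assumes "0 < Re s"
  shows "norm (\<kappa> t * f (s - \<i> * of_real t)) \<le> B * (1 + norm s) powr k * (norm (\<kappa> t) * (1 + \<bar>t\<bar>) ^ M)"
  using mult_left_mono[OF growth_vertical_power[OF assms, of t] norm_ge_zero[of "\<kappa> t"]]
  by (simp only: norm_mult mult_ac)

lemma integrable_vertical_convolution:
  assumes "0 < Re s"
  shows "integrable lborel (\<lambda>t. \<kappa> t * f (s - \<i> * of_real t))"
proof (rule Bochner_Integration.integrable_bound)
  show "integrable lborel (\<lambda>t. B * (1 + norm s) powr k * (norm (\<kappa> t) * (1 + \<bar>t\<bar>) ^ M))"
    using int by (rule integrable_mult_right)
  show "(\<lambda>t. \<kappa> t * f (s - \<i> * of_real t)) \<in> borel_measurable lborel"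
    using measurable_vertical[OF assms] by measurable
  show "AE t in lborel. norm (\<kappa> t * f (s - \<i> * of_real t)) \<le> norm (B * (1 + norm s) powr k * (norm (\<kappa> t) * (1 + \<bar>t\<bar>) ^ M))"
    using norm_vertical_convolution_le[OF assms] by (intro AE_I2) (auto intro: order_trans[OF _ abs_ge_self] simp del: abs_mult)
qed

text \<open>
  Locally uniform limit of the integrals over \<open>[- n, n]\<close>: the tails are bounded by the tails of the weighted norm of \<open>\<kappa>\<close>.
\<close>
lemma holomorphic_vertical_convolution:
  "(\<lambda>s. LINT t|lborel. \<kappa> t * f (s - \<i> * of_real t)) holomorphic_on {s. 0 < Re s}"
proof (rule holomorphic_uniform_sequence)
  let ?H = "{s::complex. 0 < Re s}"
  let ?W = "\<lambda>t. norm (\<kappa> t) * (1 + \<bar>t\<bar>) ^ M"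
  let ?F = "\<lambda>(n::nat) s. integral (cbox (- real n) (real n)) (\<lambda>t. \<kappa> t * f (s - \<i> * of_real t))"
  show op: "open ?H" by (rule open_halfspace_Re_gt)
  show "?F n holomorphic_on ?H" for n
  proof (rule leibniz_rule_holomorphic)
    show "convex ?H" by (rule convex_halfspace_Re_gt)
    show "((\<lambda>s. \<kappa> t * f (s - \<i> * of_real t)) has_field_derivative \<kappa> t * deriv f (s - \<i> * of_real t)) (at s within ?H)"
      if "s \<in> ?H" for s t
    proof -
      have "(f has_field_derivative deriv f (s - \<i> * of_real t)) (at (s - \<i> * of_real t))"
        by (rule holomorphic_derivI[OF hol op]) (use that in simp)
      moreover have "((\<lambda>s. s - \<i> * of_real t) has_field_derivative 1) (at s within ?H)"
        by (auto intro!: derivative_eq_intros)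
      ultimately have "((\<lambda>s. f (s - \<i> * of_real t)) has_field_derivative deriv f (s - \<i> * of_real t) * 1) (at s within ?H)"
        by (rule DERIV_chain2)
      from DERIV_cmult[OF this, of "\<kappa> t"] show ?thesis by simp
    qed
    show "(\<lambda>t. \<kappa> t * f (s - \<i> * of_real t)) integrable_on cbox (- real n) (real n)" if "s \<in> ?H" for s
      using that by (intro integrable_continuous continuous_on_mult continuous_on_subset[OF cont]
          continuous_on_subset[OF continuous_on_vertical[OF hol]]) auto
    have "continuous_on ?H (deriv f)"
      by (intro holomorphic_on_imp_continuous_on holomorphic_deriv hol op)
    then have "continuous_on (?H \<times> cbox (- real n) (real n)) (\<lambda>p. deriv f (fst p - \<i> * of_real (snd p)))"
      by (rule continuous_on_compose2) (auto intro!: continuous_intros)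
    moreover have "continuous_on (?H \<times> cbox (- real n) (real n)) (\<lambda>p. \<kappa> (snd p))"
      by (rule continuous_on_compose2[OF cont]) (auto intro!: continuous_intros)
    ultimately show "continuous_on (?H \<times> cbox (- real n) (real n)) (\<lambda>(s, t). \<kappa> t * deriv f (s - \<i> * of_real t))"
      unfolding case_prod_unfold by (intro continuous_on_mult)
  qed
  define \<tau> where "\<tau> n = (LINT t|lborel. indicator (- {- real n..real n}) t * ?W t)" for n :: nat
  have tail_int: "integrable lborel (\<lambda>t. indicator (- {- real n..real n}) t * ?W t)" for n :: nat
    using integrable_mult_indicator[OF _ int, of "- {- real n..real n}"] by simp
  have \<tau>: "\<tau> \<longlonglongrightarrow> 0"
  proof -
    have "\<tau> \<longlonglongrightarrow> (LINT t::real|lborel. 0)"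
      unfolding \<tau>_def
    proof (rule integral_dominated_convergence[OF _ _ int])
      show "AE t in lborel. (\<lambda>n. indicator (- {- real n..real n}) t * ?W t) \<longlonglongrightarrow> 0"
      proof (intro AE_I2 tendsto_eventually)
        fix t :: real
        obtain N :: nat where N: "\<bar>t\<bar> \<le> real N"
          using real_arch_simple by blast
        show "\<forall>\<^sub>F n in sequentially. indicator (- {- real n..real n}) t * ?W t = 0"
          using eventually_ge_at_top[of N] by eventually_elim (use N in \<open>auto simp: indicator_def\<close>)
      qed
    qed (auto simp: indicator_def)
    then show ?thesis by simp
  qed
  fix x assume "x \<in> ?H"
  then have x: "0 < Re x" by simp
  define d where "d = Re x / 2"
  have d: "0 < d" "d < Re x" using x by (auto simp: d_def)
  have sub: "cball x d \<subseteq> ?H"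
  proof
    fix s assume "s \<in> cball x d"
    then have "\<bar>Re (x - s)\<bar> \<le> d"
      using abs_Re_le_cmod[of "x - s"] by (simp add: dist_norm)
    then show "s \<in> ?H" using d by simp
  qed
  let ?C = "B * (1 + (norm x + d)) powr k"
  have dist_le: "dist (?F n s) (LINT t|lborel. \<kappa> t * f (s - \<i> * of_real t)) \<le> ?C * \<tau> n" if s: "s \<in> cball x d" for n s
  proof -
    let ?g = "\<lambda>t. \<kappa> t * f (s - \<i> * of_real t)"
    have s0: "0 < Re s" using sub s by auto
    note gi = integrable_vertical_convolution[OF s0]
    have gin: "set_integrable lborel {- real n..real n} ?g"
      unfolding set_integrable_def by (intro integrable_mult_indicator gi) auto
    have "?F n s = (LINT t|lborel. indicator {- real n..real n} t *\<^sub>R ?g t)"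
      using set_borel_integral_eq_integral(2)[OF gin] by (simp add: set_lebesgue_integral_def)
    then have eq: "?F n s - (LINT t|lborel. ?g t) = (LINT t|lborel. indicator {- real n..real n} t *\<^sub>R ?g t - ?g t)"
      using gin gi by (simp add: set_integrable_def)
    have "norm (LINT t|lborel. indicator {- real n..real n} t *\<^sub>R ?g t - ?g t) \<le> (LINT t|lborel. ?C * (indicator (- {- real n..real n}) t * ?W t))"
    proof (rule Bochner_Integration.integral_norm_bound_integral)
      show "integrable lborel (\<lambda>t. indicator {- real n..real n} t *\<^sub>R ?g t - ?g t)"
        using gin gi by (simp add: set_integrable_def)
      show "integrable lborel (\<lambda>t. ?C * (indicator (- {- real n..real n}) t * ?W t))"
        using tail_int by (rule integrable_mult_right)
      fix t
      have "norm s \<le> norm x + d"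
        using s norm_triangle_ineq2[of s x] by (simp add: dist_norm norm_minus_commute)
      then have "B * (1 + norm s) powr k * ?W t \<le> ?C * ?W t"
        using B_nonneg k(1) by (intro mult_right_mono mult_left_mono powr_mono2) auto
      with norm_vertical_convolution_le[OF s0, of t] have "norm (?g t) \<le> ?C * ?W t"
        by linarith
      then show "norm (indicator {- real n..real n} t *\<^sub>R ?g t - ?g t) \<le> ?C * (indicator (- {- real n..real n}) t * ?W t)"
        by (auto simp: indicator_def)
    qed
    also have "\<dots> = ?C * \<tau> n"
      unfolding \<tau>_def by (rule integral_mult_right_zero)
    finally show ?thesis by (simp only: dist_norm eq)
  qed
  have "uniform_limit (cball x d) ?F (\<lambda>s. LINT t|lborel. \<kappa> t * f (s - \<i> * of_real t)) sequentially"
  proof (rule uniform_limitI)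
    fix e :: real assume "0 < e"
    have "(\<lambda>n. ?C * \<tau> n) \<longlonglongrightarrow> ?C * 0"
      using \<tau> by (rule tendsto_mult_left)
    then have "\<forall>\<^sub>F n in sequentially. ?C * \<tau> n < e"
      using \<open>0 < e\<close> by (intro order_tendstoD) auto
    then show "\<forall>\<^sub>F n in sequentially. \<forall>s\<in>cball x d. dist (?F n s) (LINT t|lborel. \<kappa> t * f (s - \<i> * of_real t)) < e"
      by eventually_elim (rule ballI, rule le_less_trans[OF dist_le])
  qed
  then show "\<exists>d>0. cball x d \<subseteq> ?H \<and> uniform_limit (cball x d) ?F (\<lambda>s. LINT t|lborel. \<kappa> t * f (s - \<i> * of_real t)) sequentially"
    using d(1) sub by blast
qed

text \<open>
  The kernel is integrable against the growth of \<open>f\<close> only, not against that of the Riesz means. Therefore the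
  identity is first applied to \<open>\<kappa>(t) sinc(h t)\<^sup>N\<close>, whose transform still vanishes beyond \<open>U + N h\<close>. As \<open>h\<close> tends to
  \<open>0\<close> only finitely many coefficients are involved, and both sides converge. Both sides are holomorphic, which
  extends the identity from the far right to the whole half-plane.
\<close>
lemma multiplier_identity:
  assumes lam: "frequency lam" and ext: "extends_riesz_limit lam D f"
    and U: "\<And>u. U \<le> u \<Longrightarrow> fourier \<kappa> u = 0" and s: "0 < Re s"
  shows "(LINT t|lborel. \<kappa> t * f (s - \<i> * of_real t))
     = (\<Sum>n | 1 \<le> n \<and> lam n \<le> U. D n * fourier \<kappa> (lam n) * exp (- of_real (lam n) * s))"
proof -
  from multiplier_identity_smooth[OF lam ext]
  obtain \<sigma> and N :: nat where smooth:
    "\<forall>\<kappa> U s. \<kappa> \<in> borel_measurable borel \<longrightarrow>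
       integrable lborel (\<lambda>t. norm (\<kappa> t) * (1 + \<bar>t\<bar>) ^ N) \<longrightarrow>
       (\<forall>u\<ge>U. fourier \<kappa> u = 0) \<longrightarrow> \<sigma> < Re s \<longrightarrow>
       (LINT t|lborel. \<kappa> t * f (s - \<i> * of_real t))
         = (\<Sum>n | 1 \<le> n \<and> lam n \<le> U. D n * fourier \<kappa> (lam n) * exp (- of_real (lam n) * s))"
    by (elim exE)
  let ?H = "\<lambda>s. LINT t|lborel. \<kappa> t * f (s - \<i> * of_real t)"
  let ?S = "\<lambda>U s. \<Sum>n | 1 \<le> n \<and> lam n \<le> U. D n * fourier \<kappa> (lam n) * exp (- of_real (lam n) * s)"
  have far: "?H s = ?S U s" if "max \<sigma> 0 < Re s" for s
  proof -
    \<comment> \<open>\<open>h \<le> 1\<close>, so that all regularised transforms vanish beyond the common bound \<open>U + N\<close>.\<close>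
    define h where "h j = 1 / real (Suc j)" for j
    have h: "0 < h j" "h j \<le> 1" for j
      by (auto simp: h_def)
    define \<rho> where "\<rho> j t = \<kappa> t * of_real (sinc (h j * t)) ^ N" for j t
    have h0: "(\<lambda>j. h j * t) \<longlonglongrightarrow> 0" for t
      using tendsto_mult_right[OF LIMSEQ_inverse_real_of_nat, of t] by (simp add: h_def inverse_eq_divide)
    have sinc_lim: "(\<lambda>j. sinc (h j * t)) \<longlonglongrightarrow> 1" for t
      using isCont_tendsto_compose[OF isCont_sinc[of 0] h0[of t]] by simp
    have \<rho>_lim: "(\<lambda>j. \<rho> j t) \<longlonglongrightarrow> \<kappa> t" for t
    proof -
      have "(\<lambda>j. \<kappa> t * of_real (sinc (h j * t)) ^ N) \<longlonglongrightarrow> \<kappa> t * of_real 1 ^ N"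
        by (rule tendsto_intros sinc_lim)+
      then show ?thesis by (simp add: \<rho>_def)
    qed
    have m[measurable]: "\<rho> j \<in> borel_measurable borel" for j
      unfolding \<rho>_def by measurable
    have \<rho>_le: "norm (\<rho> j t) \<le> norm (\<kappa> t)" for j t
    proof -
      have "norm (complex_of_real (sinc (h j * t)) ^ N) \<le> 1"
        unfolding norm_power norm_of_real by (intro power_le_one abs_sinc_le_1 abs_ge_zero)
      from mult_left_mono[OF this norm_ge_zero[of "\<kappa> t"]] show ?thesis
        by (simp only: \<rho>_def norm_mult mult_1_right)
    qed
    have "(LINT t|lborel. \<rho> j t * f (s - \<i> * of_real t))
       = (\<Sum>n | 1 \<le> n \<and> lam n \<le> U + real N. D n * fourier (\<rho> j) (lam n) * exp (- of_real (lam n) * s))" for j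
    proof (rule smooth[rule_format, OF m])
      show "integrable lborel (\<lambda>t. norm (\<rho> j t) * (1 + \<bar>t\<bar>) ^ N)"
      proof (rule Bochner_Integration.integrable_bound)
        show "integrable lborel (\<lambda>t. (2 / h j) ^ N * norm (\<kappa> t))"
          using kernel_integrable by auto
        show "AE t in lborel. norm (norm (\<rho> j t) * (1 + \<bar>t\<bar>) ^ N) \<le> norm ((2 / h j) ^ N * norm (\<kappa> t))"
        proof (intro AE_I2)
          fix t :: real
          have "1 + \<bar>t\<bar> \<le> (1 + \<bar>h j * t\<bar>) / h j"
            using h[of j] by (simp add: abs_mult divide_simps distrib_left mult.commute)
          then have "\<bar>sinc (h j * t)\<bar> * (1 + \<bar>t\<bar>) \<le> \<bar>sinc (h j * t)\<bar> * ((1 + \<bar>h j * t\<bar>) / h j)"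
            by (intro mult_left_mono) auto
          also have "\<dots> \<le> 2 / h j"
            using abs_sinc_mult_le[of "h j * t"] h[of j] by (simp only: times_divide_eq_right divide_right_mono less_imp_le)
          finally have "(\<bar>sinc (h j * t)\<bar> * (1 + \<bar>t\<bar>)) ^ N \<le> (2 / h j) ^ N"
            by (intro power_mono) auto
          from mult_left_mono[OF this norm_ge_zero[of "\<kappa> t"]]
          have "norm (\<rho> j t) * (1 + \<bar>t\<bar>) ^ N \<le> norm (\<kappa> t) * (2 / h j) ^ N"
            by (simp only: \<rho>_def norm_mult norm_power norm_of_real power_mult_distrib mult.assoc)
          then show "norm (norm (\<rho> j t) * (1 + \<bar>t\<bar>) ^ N) \<le> norm ((2 / h j) ^ N * norm (\<kappa> t))"
            using h[of j] by (simp add: mult.commute)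
        qed
      qed measurable
      show "fourier (\<rho> j) u = 0" if "U + real N \<le> u" for u
        unfolding \<rho>_def using that h[of j] mult_left_mono[OF h(2)[of j], of "real N"]
        by (intro fourier_sinc_power_eq_0[OF kernel_integrable _ U]) auto
      show "\<sigma> < Re s" using that by simp
    qed
    moreover have "(\<lambda>j. LINT t|lborel. \<rho> j t * f (s - \<i> * of_real t)) \<longlonglongrightarrow> ?H s"
    proof (rule integral_dominated_convergence)
      have s: "0 < Re s" using that by simp
      note measurable_vertical[OF s, measurable]
      show "integrable lborel (\<lambda>t. norm (\<kappa> t * f (s - \<i> * of_real t)))"
        using integrable_vertical_convolution[OF s] by (rule integrable_norm)
      show "AE t in lborel. (\<lambda>j. \<rho> j t * f (s - \<i> * of_real t)) \<longlonglongrightarrow> \<kappa> t * f (s - \<i> * of_real t)"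
        by (intro AE_I2 tendsto_intros \<rho>_lim)
      show "AE t in lborel. norm (\<rho> j t * f (s - \<i> * of_real t)) \<le> norm (\<kappa> t * f (s - \<i> * of_real t))" for j
        using \<rho>_le by (intro AE_I2) (simp add: norm_mult mult_right_mono)
      show "(\<lambda>t. \<kappa> t * f (s - \<i> * of_real t)) \<in> borel_measurable lborel"
        by measurable
      show "(\<lambda>t. \<rho> j t * f (s - \<i> * of_real t)) \<in> borel_measurable lborel" for j
        by measurable
    qed
    moreover have "(\<lambda>j. fourier (\<rho> j) u) \<longlonglongrightarrow> fourier \<kappa> u" for u
      unfolding fourier_def
    proof (rule integral_dominated_convergence)
      show "integrable lborel (\<lambda>t. norm (\<kappa> t))"
        using kernel_integrable by auto
      show "AE t in lborel. (\<lambda>j. \<rho> j t * cis (u * t)) \<longlonglongrightarrow> \<kappa> t * cis (u * t)"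
        by (intro AE_I2 tendsto_intros \<rho>_lim)
    qed (use \<rho>_le in \<open>auto simp: norm_mult\<close>)
    then have "(\<lambda>j. \<Sum>n | 1 \<le> n \<and> lam n \<le> U + real N. D n * fourier (\<rho> j) (lam n) * exp (- of_real (lam n) * s))
       \<longlonglongrightarrow> ?S (U + real N) s"
      by (intro tendsto_intros)
    ultimately have "?H s = ?S (U + real N) s"
      using LIMSEQ_unique by simp
    also have "\<dots> = ?S U s"
    proof (rule sum.mono_neutral_right)
      have "fourier \<kappa> (lam i) = 0" if "\<not> lam i \<le> U" for i
        using that by (intro U) simp
      then show "\<forall>i\<in>{n. 1 \<le> n \<and> lam n \<le> U + real N} - {n. 1 \<le> n \<and> lam n \<le> U}.
          D i * fourier \<kappa> (lam i) * exp (- of_real (lam i) * s) = 0"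
        by auto
    qed (use finite_frequency_le[OF lam] in auto)
    finally show ?thesis .
  qed
  show ?thesis
  proof (rule analytic_continuation_open[of "{s. max \<sigma> 0 < Re s}" "{s. 0 < Re s}" ?H "?S U" s])
    show "{s. max \<sigma> 0 < Re s} \<noteq> {}"
      by (auto intro!: exI[of _ "complex_of_real (max \<sigma> 0 + 1)"])
    show "connected {s::complex. 0 < Re s}"
      by (intro convex_connected convex_halfspace_Re_gt)
    show "?S U holomorphic_on {s. 0 < Re s}"
      by (intro holomorphic_intros)
    show "open {s. max \<sigma> 0 < Re s}" "open {s::complex. 0 < Re s}"
      by (rule open_halfspace_Re_gt)+
  qed (use s far holomorphic_vertical_convolution in auto)
qed

end

end

section \<open>Riesz weights as superpositions of bumps\<close>

text \<open>
  The multiplier \<open>\<phi>((u - c)/r)\<close> has the kernel \<open>r \<kappa>(r t) exp(- i c t)\<close>. The modulation does not change absolute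
  values, so the bound is independent of \<open>c\<close>; substituting \<open>r t\<close> turns the weight \<open>1 + \<bar>t\<bar>\<close> into at most
  \<open>max(1, 1/r) (1 + \<bar>t\<bar>)\<close>.
\<close>
lemma (in half_plane_growth) bump_sum_bound:
  assumes cont: "continuous_on UNIV \<kappa>" and int: "integrable lborel (\<lambda>t. norm (\<kappa> t) * (1 + \<bar>t\<bar>) ^ M)"
    and \<phi>: "\<And>u. fourier \<kappa> u = complex_of_real (\<phi> u)" "\<And>u. A \<le> u \<Longrightarrow> \<phi> u = 0"
    and lam: "frequency lam" and ext: "extends_riesz_limit lam D f"
    and s: "0 < Re s" and r: "0 < r"
  shows "norm (\<Sum>n | 1 \<le> n \<and> lam n \<le> c + A * r. D n * of_real (\<phi> ((lam n - c) / r)) * exp (- of_real (lam n) * s))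
    \<le> B * (1 + norm s) powr k * max 1 (1 / r) powr k * (LINT t|lborel. norm (\<kappa> t) * (1 + \<bar>t\<bar>) ^ M)"
proof -
  let ?\<kappa> = "\<lambda>t. of_real r * \<kappa> (r * t) * cis (- c * t)"
  let ?m = "max 1 (1 / r)"
  let ?w = "\<lambda>t. norm (\<kappa> t) * (1 + \<bar>t\<bar>) ^ M"
  have cont': "continuous_on UNIV ?\<kappa>"
    by (intro continuous_intros continuous_on_compose2[OF cont]) auto
  have scale: "1 + \<bar>t\<bar> \<le> ?m * (1 + \<bar>r * t\<bar>)" for t
  proof -
    have "1 * 1 \<le> ?m * 1" by simp
    moreover have "\<bar>t\<bar> = (1 / r) * \<bar>r * t\<bar>"
      using r by (simp add: abs_mult)
    moreover have "(1 / r) * \<bar>r * t\<bar> \<le> ?m * \<bar>r * t\<bar>"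
      by (intro mult_right_mono) auto
    ultimately show ?thesis by (simp only: distrib_left)
  qed
  have intr: "integrable lborel (\<lambda>t. ?w (r * t))"
    using lborel_integrable_real_affine[OF int, of r 0] r by simp
  have int': "integrable lborel (\<lambda>t. norm (?\<kappa> t) * (1 + \<bar>t\<bar>) ^ M)"
  proof (rule Bochner_Integration.integrable_bound)
    show "integrable lborel (\<lambda>t. r * ?m ^ M * ?w (r * t))"
      using intr by (rule integrable_mult_right)
    show "(\<lambda>t. norm (?\<kappa> t) * (1 + \<bar>t\<bar>) ^ M) \<in> borel_measurable lborel"
      using borel_measurable_continuous_onI[OF cont'] by measurable
    show "AE t in lborel. norm (norm (?\<kappa> t) * (1 + \<bar>t\<bar>) ^ M) \<le> norm (r * ?m ^ M * ?w (r * t))"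
    proof (intro AE_I2)
      fix t
      have "(1 + \<bar>t\<bar>) ^ M \<le> ?m ^ M * (1 + \<bar>r * t\<bar>) ^ M"
        using power_mono[OF scale[of t], of M] by (simp add: power_mult_distrib)
      then have "r * norm (\<kappa> (r * t)) * (1 + \<bar>t\<bar>) ^ M \<le> r * norm (\<kappa> (r * t)) * (?m ^ M * (1 + \<bar>r * t\<bar>) ^ M)"
        using r by (intro mult_left_mono) auto
      also have "\<dots> = r * ?m ^ M * ?w (r * t)"
        by (simp only: mult_ac)
      finally have "norm (?\<kappa> t) * (1 + \<bar>t\<bar>) ^ M \<le> r * ?m ^ M * ?w (r * t)"
        using r by (simp add: norm_mult)
      moreover have "0 \<le> norm (?\<kappa> t) * (1 + \<bar>t\<bar>) ^ M"
        by simp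
      ultimately show "norm (norm (?\<kappa> t) * (1 + \<bar>t\<bar>) ^ M) \<le> norm (r * ?m ^ M * ?w (r * t))"
        unfolding real_norm_def by linarith
    qed
  qed
  have four: "fourier ?\<kappa> u = of_real (\<phi> ((u - c) / r))" for u
    unfolding fourier_scale_modulate[OF r] \<phi>(1) ..
  have "fourier ?\<kappa> u = 0" if "c + A * r \<le> u" for u
  proof -
    have "A \<le> (u - c) / r"
      using that r by (simp add: le_divide_eq)
    then show ?thesis unfolding four by (simp add: \<phi>(2))
  qed
  from multiplier_identity[OF cont' int' lam ext this s]
  have eq: "(\<Sum>n | 1 \<le> n \<and> lam n \<le> c + A * r. D n * of_real (\<phi> ((lam n - c) / r)) * exp (- of_real (lam n) * s))
    = (LINT t|lborel. ?\<kappa> t * f (s - \<i> * of_real t))"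
    unfolding four by simp
  let ?C = "B * (1 + norm s) powr k * ?m powr k"
  have "norm (LINT t|lborel. ?\<kappa> t * f (s - \<i> * of_real t)) \<le> (LINT t|lborel. ?C * (r * ?w (r * t)))"
  proof (rule Bochner_Integration.integral_norm_bound_integral)
    show "integrable lborel (\<lambda>t. ?\<kappa> t * f (s - \<i> * of_real t))"
      by (rule integrable_vertical_convolution[OF cont' int' s])
    show "integrable lborel (\<lambda>t. ?C * (r * ?w (r * t)))"
      using intr by (intro integrable_mult_right)
    fix t
    have "(1 + \<bar>t\<bar>) powr k \<le> (?m * (1 + \<bar>r * t\<bar>)) powr k"
      using scale k by (intro powr_mono2) auto
    also have "\<dots> \<le> ?m powr k * (1 + \<bar>r * t\<bar>) ^ M"
      using powr_le_power[OF k(2), of "1 + \<bar>r * t\<bar>"] by (simp add: powr_mult mult_left_mono)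
    finally have "B * (1 + norm s) powr k * (1 + \<bar>t\<bar>) powr k \<le> B * (1 + norm s) powr k * (?m powr k * (1 + \<bar>r * t\<bar>) ^ M)"
      using B_nonneg by (intro mult_left_mono) auto
    then have "norm (f (s - \<i> * of_real t)) \<le> ?C * (1 + \<bar>r * t\<bar>) ^ M"
      using growth_vertical[OF s, of t] by (simp only: mult.assoc)
    from mult_left_mono[OF this norm_ge_zero[of "?\<kappa> t"]]
    show "norm (?\<kappa> t * f (s - \<i> * of_real t)) \<le> ?C * (r * ?w (r * t))"
      using r by (simp add: norm_mult mult_ac)
  qed
  also have "\<dots> = ?C * (\<bar>r\<bar> *\<^sub>R (LINT t|lborel. ?w (0 + r * t)))"
    using r by simp
  also have "\<bar>r\<bar> *\<^sub>R (LINT t|lborel. ?w (0 + r * t)) = (LINT t|lborel. ?w t)"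
    using r by (intro lborel_integral_real_affine[symmetric]) auto
  finally show ?thesis unfolding eq .
qed

text \<open>
  Only scales \<open>r\<close> with \<open>1 < y/r < S\<close> contribute, so any \<open>E\<close> containing \<open>[y/S, y]\<close> represents the same power of \<open>y\<close>.
  A single set \<open>E\<close> can thus serve all frequencies at once.
\<close>
lemma scale_superposition:
  fixes \<Phi> :: "real \<Rightarrow> real"
  assumes y: "0 < y" and \<Phi>: "\<And>\<rho>. \<rho> \<le> 1 \<or> S \<le> \<rho> \<Longrightarrow> \<Phi> \<rho> = 0" and S: "1 < S"
    and E: "{y / S..y} \<subseteq> E" "E \<subseteq> {0<..}"
  shows "(LINT r|lborel. indicator E r * (r powr (k - 1) * \<Phi> (y / r)))
    = y powr k * (LINT r|lborel. indicator {1/S..1} r * (r powr (k - 1) * \<Phi> (1 / r)))"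
proof -
  have "(LINT r|lborel. indicator E r * (r powr (k - 1) * \<Phi> (y / r)))
     = (LINT r|lborel. indicator {y/S..y} r * (r powr (k - 1) * \<Phi> (y / r)))"
  proof (intro Bochner_Integration.integral_cong refl)
    fix r
    show "indicator E r * (r powr (k - 1) * \<Phi> (y / r)) = indicator {y/S..y} r * (r powr (k - 1) * \<Phi> (y / r))"
    proof (cases "r \<in> E \<and> r \<notin> {y/S..y}")
      case True
      then have "0 < r" using E by auto
      then have "y / r \<le> 1 \<or> S \<le> y / r"
        using True S by (auto simp: field_simps)
      then show ?thesis by (simp add: \<Phi>)
    qed (use E in \<open>auto simp: indicator_def\<close>)
  qed
  also have "\<dots> = \<bar>y\<bar> *\<^sub>R (LINT r|lborel. indicator {y/S..y} (0 + y * r) * ((0 + y * r) powr (k - 1) * \<Phi> (y / (0 + y * r))))"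
    using y by (intro lborel_integral_real_affine) auto
  also have "\<dots> = y * (LINT r|lborel. y powr (k - 1) * (indicator {1/S..1} r * (r powr (k - 1) * \<Phi> (1 / r))))"
  proof -
    have "indicator {y/S..y} (0 + y * r) * ((0 + y * r) powr (k - 1) * \<Phi> (y / (0 + y * r)))
       = y powr (k - 1) * (indicator {1/S..1} r * (r powr (k - 1) * \<Phi> (1 / r)))" for r
    proof (cases "r \<in> {1/S..1}")
      case True
      moreover have "0 < 1 / S" using S by simp
      ultimately have "0 < r" by (metis atLeastAtMost_iff less_le_trans)
      moreover have "y * r \<in> {y/S..y}"
        using True y S by (auto simp: field_simps)
      ultimately show ?thesis
        using True y by (simp add: powr_mult)
    next
      case False
      then have "y * r \<notin> {y/S..y}"
        using y S by (auto simp: field_simps)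
      then show ?thesis using False by simp
    qed
    then show ?thesis using y by (simp only: abs_of_pos real_scaleR_def)
  qed
  also have "\<dots> = (y powr 1 * y powr (k - 1)) * (LINT r|lborel. indicator {1/S..1} r * (r powr (k - 1) * \<Phi> (1 / r)))"
    using y by simp
  also have "y powr 1 * y powr (k - 1) = y powr k"
    by (subst powr_add[symmetric]) simp
  finally show ?thesis .
qed

lemma interval_log_integral:
  fixes a b :: real
  assumes "0 < a" "a \<le> b"
  shows "has_bochner_integral lborel (\<lambda>r. indicator {a..b} r * (1 / r)) (ln b - ln a)"
proof -
  have "has_bochner_integral lborel (\<lambda>r. indicator {a..b} r *\<^sub>R (1 / r)) (ln b - ln a)"
  proof (rule has_bochner_integral_FTC_Icc[OF assms(2)])
    show "(ln has_vector_derivative 1 / r) (at r within {a..b})" if "a \<le> r" "r \<le> b" for r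
    proof (rule has_vector_derivative_at_within)
      have "(ln has_real_derivative 1 / r) (at r)"
        using that assms(1) by (intro DERIV_ln_divide) linarith
      then show "(ln has_vector_derivative 1 / r) (at r)"
        by (simp only: has_real_derivative_iff_has_vector_derivative)
    qed
    show "continuous_on {a..b} (\<lambda>r. 1 / r)"
      using assms(1) by (intro continuous_intros) auto
  qed
  then show ?thesis by simp
qed

lemma scale_superposition_integrable:
  fixes \<Phi> :: "real \<Rightarrow> real"
  assumes y: "0 < y" and \<Phi>: "\<And>\<rho>. \<rho> \<le> 1 \<or> S \<le> \<rho> \<Longrightarrow> \<Phi> \<rho> = 0" and S: "1 < S"
    and E: "{y / S..y} \<subseteq> E" "E \<subseteq> {0<..}" and cont: "continuous_on UNIV \<Phi>"
  shows "integrable lborel (\<lambda>r. indicator E r * (r powr (k - 1) * \<Phi> (y / r)))"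
proof -
  have pos: "0 < r" if "r \<in> {y/S..y}" for r
    using that y S by (auto intro: less_le_trans[of 0 "y / S"])
  have "continuous_on {y/S..y} (\<lambda>r. r powr (k - 1) * \<Phi> (y / r))"
    using pos by (intro continuous_intros continuous_on_compose2[OF cont]) force+
  from borel_integrable_atLeastAtMost'[OF this]
  have "integrable lborel (\<lambda>r. indicator {y/S..y} r * (r powr (k - 1) * \<Phi> (y / r)))"
    by (simp add: set_integrable_def)
  also have "(\<lambda>r. indicator {y/S..y} r * (r powr (k - 1) * \<Phi> (y / r))) = (\<lambda>r. indicator E r * (r powr (k - 1) * \<Phi> (y / r)))"
  proof
    fix r
    show "indicator {y/S..y} r * (r powr (k - 1) * \<Phi> (y / r)) = indicator E r * (r powr (k - 1) * \<Phi> (y / r))"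
    proof (cases "r \<in> E \<and> r \<notin> {y/S..y}")
      case True
      then have "0 < r" using E by auto
      then have "y / r \<le> 1 \<or> S \<le> y / r"
        using True S by (auto simp: field_simps)
      then show ?thesis by (simp add: \<Phi>)
    qed (use E in \<open>auto simp: indicator_def\<close>)
  qed
  finally show ?thesis .
qed

text \<open>
  The constant in \<open>scale_superposition\<close> for \<open>\<Phi>(\<rho>) = \<phi>(A + 1 - \<rho>)\<close>. The reflected bump is shifted
  so that its support \<open>[1, 2 A + 1]\<close> keeps away from \<open>0\<close>.
\<close>
definition bump_moment :: "real \<Rightarrow> (real \<Rightarrow> real) \<Rightarrow> real \<Rightarrow> real" where
  "bump_moment k \<phi> A = (LINT r|lborel. indicator {1/(2*A+1)..1} r * (r powr (k - 1) * \<phi> (A + 1 - 1 / r)))"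

lemma bump_moment_pos:
  assumes cont: "continuous_on UNIV \<phi>" and \<phi>: "\<And>u. 0 \<le> \<phi> u" "0 < \<phi> 0" and A: "0 < A"
  shows "0 < bump_moment k \<phi> A"
proof -
  let ?a = "1 / (2*A+1)"
  \<comment> \<open>Truncating \<open>r\<close> from below changes nothing on the interval of integration and makes the integrand continuous everywhere.\<close>
  let ?g = "\<lambda>r. max ?a r powr (k - 1) * \<phi> (A + 1 - 1 / max ?a r)"
  have a: "0 < ?a" using A by simp
  then have pos: "0 < max ?a r" for r by (simp add: less_max_iff_disj)
  have ne: "max ?a r \<noteq> 0" for r using pos[of r] by linarith
  have cg: "continuous_on UNIV ?g"
    by (intro continuous_intros continuous_on_compose2[OF cont] ballI ne subset_UNIV)
  have "0 < (LINT r|lborel. indicator {?a..1} r * ?g r)"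
  proof (rule integral_continuous_nonneg_pos[OF cg, where c = "1 / (A + 1)"])
    show "0 \<le> ?g r" for r using \<phi>(1) by simp
    have "max ?a (1 / (A + 1)) = 1 / (A + 1)"
      using A by (intro max_absorb2) (simp add: field_simps)
    then show "0 < ?g (1 / (A + 1))" using \<phi>(2) A by simp
    show "?a < 1 / (A + 1)" "1 / (A + 1) < 1" using A by (auto simp: field_simps)
    show "integrable lborel (\<lambda>r. indicator {?a..1} r * ?g r)"
      using borel_integrable_atLeastAtMost'[OF continuous_on_subset[OF cg subset_UNIV], of ?a 1]
      by (simp add: set_integrable_def)
  qed
  also have "\<dots> = bump_moment k \<phi> A"
    unfolding bump_moment_def by (intro Bochner_Integration.integral_cong refl) (auto simp: indicator_def)
  finally show ?thesis .
qed

text \<open>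
  The intervals \<open>[a i, b i]\<close> cover all scales that see some frequency below \<open>x\<close>. At each such scale \<open>r \<le> x\<close> the
  bump sum is bounded by \<open>max(1, 1/r)\<^sup>k\<close>, so \<open>r\<^sup>k\<^sup>-\<^sup>1 max(1, 1/r)\<^sup>k = max(r, 1)\<^sup>k / r\<close> is integrated
  over the intervals, which gives their logarithmic lengths.
\<close>
lemma (in half_plane_growth) superposition_bound:
  assumes cont: "continuous_on UNIV \<kappa>" and int: "integrable lborel (\<lambda>t. norm (\<kappa> t) * (1 + \<bar>t\<bar>) ^ M)"
    and \<phi>: "\<And>u. fourier \<kappa> u = complex_of_real (\<phi> u)" "\<And>u. A \<le> \<bar>u\<bar> \<Longrightarrow> \<phi> u = 0"
    and contp: "continuous_on UNIV \<phi>" and A: "0 < A"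
    and lam: "frequency lam" and ext: "extends_riesz_limit lam D f"
    and s: "0 < Re s"
    and I: "finite I" "\<And>i. i \<in> I \<Longrightarrow> 0 < a i" "\<And>i. i \<in> I \<Longrightarrow> a i \<le> b i" "\<And>i. i \<in> I \<Longrightarrow> b i \<le> x"
    and cover: "\<And>n. 1 \<le> n \<Longrightarrow> lam n < x \<Longrightarrow> \<exists>i\<in>I. a i \<le> (x - lam n) / (2*A+1) \<and> x - lam n \<le> b i"
  shows "bump_moment k \<phi> A * norm (\<Sum>n | 1 \<le> n \<and> lam n < x. D n * of_real ((x - lam n) powr k) * exp (- of_real (lam n) * s))
    \<le> B * (1 + norm s) powr k * max x 1 powr k * (LINT t|lborel. norm (\<kappa> t) * (1 + \<bar>t\<bar>) ^ M) * (\<Sum>i\<in>I. ln (b i) - ln (a i))"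
proof -
  let ?S = "2*A+1"
  let ?J = "{n. 1 \<le> n \<and> lam n < x}"
  let ?W = "LINT t|lborel. norm (\<kappa> t) * (1 + \<bar>t\<bar>) ^ M"
  define \<Phi> where "\<Phi> \<rho> = \<phi> (A + 1 - \<rho>)" for \<rho>
  define E where "E = (\<Union>i\<in>I. {a i..b i})"
  let ?e = "\<lambda>n. D n * exp (- of_real (lam n) * s)"
  define G where "G r = (\<Sum>n\<in>?J. ?e n * of_real (\<Phi> ((x - lam n) / r)))" for r
  have S: "1 < ?S" using A by simp
  have \<Phi>0: "\<Phi> \<rho> = 0" if "\<rho> \<le> 1 \<or> ?S \<le> \<rho>" for \<rho>
    unfolding \<Phi>_def using that A by (intro \<phi>(2)) auto
  have cont\<Phi>: "continuous_on UNIV \<Phi>"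
    unfolding \<Phi>_def by (intro continuous_on_compose2[OF contp] continuous_intros) auto
  have fin: "finite ?J"
    by (rule finite_subset[OF _ finite_frequency_le[OF lam, of x]]) auto
  have Epos: "E \<subseteq> {0<..}"
    unfolding E_def by (auto intro: less_le_trans[OF I(2)])
  have Esub: "{(x - lam n) / ?S..x - lam n} \<subseteq> E" if "n \<in> ?J" for n
    using cover[of n] that unfolding E_def by fastforce
  have W0: "0 \<le> ?W" by (intro Bochner_Integration.integral_nonneg) auto
  have G_bound: "norm (G r) \<le> B * (1 + norm s) powr k * max 1 (1 / r) powr k * ?W" if r: "0 < r" for r
  proof -
    \<comment> \<open>The centre for which the argument of the bump, \<open>(\<lambda>\<^sub>n - c)/r\<close>, equals \<open>A + 1 - (x - \<lambda>\<^sub>n)/r\<close>.\<close>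
    let ?c = "x - (A + 1) * r"
    have c: "?c + A * r = x - r" by (simp add: algebra_simps)
    have arg: "(lam n - ?c) / r = A + 1 - (x - lam n) / r" for n
      using r by (simp add: field_simps)
    have "G r = (\<Sum>n | 1 \<le> n \<and> lam n \<le> ?c + A * r. D n * of_real (\<phi> ((lam n - ?c) / r)) * exp (- of_real (lam n) * s))"
      unfolding G_def arg c \<Phi>_def[symmetric]
    proof (rule sum.mono_neutral_cong_right[OF fin])
      show "{n. 1 \<le> n \<and> lam n \<le> x - r} \<subseteq> ?J" using r by auto
      have "\<Phi> ((x - lam n) / r) = 0" if "\<not> lam n \<le> x - r" for n
        using that r by (intro \<Phi>0) (auto simp: field_simps)
      then show "\<forall>n\<in>?J - {n. 1 \<le> n \<and> lam n \<le> x - r}. ?e n * of_real (\<Phi> ((x - lam n) / r)) = 0"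
        by auto
    qed (simp add: mult_ac)
    then show ?thesis
      using bump_sum_bound[OF cont int \<phi>(1) _ lam ext s r, of A ?c] \<phi>(2) by simp
  qed
  have term_int: "integrable lborel (\<lambda>r. indicator E r * (r powr (k - 1) * \<Phi> ((x - lam n) / r)))" if "n \<in> ?J" for n
    using that by (intro scale_superposition_integrable[OF _ \<Phi>0 S Esub[OF that] Epos cont\<Phi>]) auto
  have eq: "of_real (bump_moment k \<phi> A) * (\<Sum>n\<in>?J. D n * of_real ((x - lam n) powr k) * exp (- of_real (lam n) * s))
    = (LINT r|lborel. (\<Sum>n\<in>?J. ?e n * of_real (indicator E r * (r powr (k - 1) * \<Phi> ((x - lam n) / r)))))"
  proof -
    have "(LINT r|lborel. (\<Sum>n\<in>?J. ?e n * of_real (indicator E r * (r powr (k - 1) * \<Phi> ((x - lam n) / r)))))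
      = (\<Sum>n\<in>?J. LINT r|lborel. ?e n * of_real (indicator E r * (r powr (k - 1) * \<Phi> ((x - lam n) / r))))"
      using term_int by (intro Bochner_Integration.integral_sum integrable_mult_right integrable_of_real)
    also have "\<dots> = (\<Sum>n\<in>?J. of_real (bump_moment k \<phi> A) * (D n * of_real ((x - lam n) powr k) * exp (- of_real (lam n) * s)))"
    proof (intro sum.cong refl)
      fix n assume n: "n \<in> ?J"
      have "(LINT r|lborel. indicator E r * (r powr (k - 1) * \<Phi> ((x - lam n) / r))) = (x - lam n) powr k * bump_moment k \<phi> A"
        using n unfolding bump_moment_def \<Phi>_def[symmetric]
        by (intro scale_superposition[OF _ \<Phi>0 S Esub[OF n] Epos]) auto
      then show "(LINT r|lborel. ?e n * of_real (indicator E r * (r powr (k - 1) * \<Phi> ((x - lam n) / r))))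
        = of_real (bump_moment k \<phi> A) * (D n * of_real ((x - lam n) powr k) * exp (- of_real (lam n) * s))"
        by (subst integral_mult_right_zero, subst integral_complex_of_real) (simp add: mult_ac)
    qed
    finally show ?thesis by (simp only: sum_distrib_left)
  qed
  let ?C = "B * (1 + norm s) powr k * max x 1 powr k * ?W"
  have C0: "0 \<le> ?C" using B_nonneg W0 by simp
  have logs: "has_bochner_integral lborel (\<lambda>r. ?C * (\<Sum>i\<in>I. indicator {a i..b i} r * (1 / r))) (?C * (\<Sum>i\<in>I. ln (b i) - ln (a i)))"
    using I by (intro has_bochner_integral_mult_right has_bochner_integral_sum interval_log_integral)
  have "norm (LINT r|lborel. (\<Sum>n\<in>?J. ?e n * of_real (indicator E r * (r powr (k - 1) * \<Phi> ((x - lam n) / r)))))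
    \<le> (LINT r|lborel. ?C * (\<Sum>i\<in>I. indicator {a i..b i} r * (1 / r)))"
  proof (rule Bochner_Integration.integral_norm_bound_integral)
    show "integrable lborel (\<lambda>r. \<Sum>n\<in>?J. ?e n * of_real (indicator E r * (r powr (k - 1) * \<Phi> ((x - lam n) / r))))"
      using term_int by (intro Bochner_Integration.integrable_sum integrable_mult_right integrable_of_real)
    show "integrable lborel (\<lambda>r. ?C * (\<Sum>i\<in>I. indicator {a i..b i} r * (1 / r)))"
      using logs by (rule integrable.intros)
    fix r
    show "norm (\<Sum>n\<in>?J. ?e n * of_real (indicator E r * (r powr (k - 1) * \<Phi> ((x - lam n) / r))))
      \<le> ?C * (\<Sum>i\<in>I. indicator {a i..b i} r * (1 / r))"
    proof (cases "r \<in> E")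
      case True
      then obtain i where i: "i \<in> I" "r \<in> {a i..b i}" by (auto simp: E_def)
      have r: "0 < r" "r \<le> x" using True Epos i I(4)[of i] by auto
      have "(\<Sum>n\<in>?J. ?e n * of_real (indicator E r * (r powr (k - 1) * \<Phi> ((x - lam n) / r)))) = of_real (r powr (k - 1)) * G r"
        using True unfolding G_def sum_distrib_left by (intro sum.cong refl) (simp add: mult_ac)
      then have "norm (\<Sum>n\<in>?J. ?e n * of_real (indicator E r * (r powr (k - 1) * \<Phi> ((x - lam n) / r)))) = r powr (k - 1) * norm (G r)"
        by (simp add: norm_mult)
      also have "\<dots> \<le> r powr (k - 1) * (B * (1 + norm s) powr k * max 1 (1 / r) powr k * ?W)"
        using G_bound[OF r(1)] by (intro mult_left_mono) auto
      also have "\<dots> = (B * (1 + norm s) powr k * ?W) * (r powr (k - 1) * max 1 (1 / r) powr k)"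
        by (simp only: mult_ac)
      also have "r powr (k - 1) * max 1 (1 / r) powr k = (1 / r) * max r 1 powr k"
      proof -
        have "r * max 1 (1 / r) = max r 1"
          using r by (auto simp: max_def field_simps)
        then have "max r 1 powr k = r powr k * max 1 (1 / r) powr k"
          using r by (metis less_imp_le max.cobounded1 order_trans powr_mult zero_le_one)
        moreover have "r powr (k - 1) = (1 / r) * r powr k"
          using r by (simp add: powr_diff)
        ultimately show ?thesis by simp
      qed
      also have "(B * (1 + norm s) powr k * ?W) * ((1 / r) * max r 1 powr k) \<le> (B * (1 + norm s) powr k * ?W) * ((1 / r) * max x 1 powr k)"
        using r k B_nonneg W0 by (intro mult_left_mono powr_mono2) auto
      also have "\<dots> = ?C * (indicator {a i..b i} r * (1 / r))"
        using i by simp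
      also have "\<dots> \<le> ?C * (\<Sum>i\<in>I. indicator {a i..b i} r * (1 / r))"
        using i I r by (intro mult_left_mono[OF _ C0] member_le_sum) auto
      finally show ?thesis .
    next
      case False
      then have "indicator {a i..b i} r = (0::real)" if "i \<in> I" for i
        using that by (auto simp: E_def indicator_def)
      then have "(\<Sum>i\<in>I. indicator {a i..b i} r * (1 / r)) = 0"
        by (intro sum.neutral) auto
      then show ?thesis using False by simp
    qed
  qed
  also have "\<dots> = ?C * (\<Sum>i\<in>I. ln (b i) - ln (a i))"
    by (rule has_bochner_integral_integral_eq[OF logs])
  finally have "norm (of_real (bump_moment k \<phi> A) * (\<Sum>n\<in>?J. D n * of_real ((x - lam n) powr k) * exp (- of_real (lam n) * s)))
     \<le> ?C * (\<Sum>i\<in>I. ln (b i) - ln (a i))"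
    unfolding eq .
  moreover have "bump_moment k \<phi> A \<le> \<bar>bump_moment k \<phi> A\<bar>" by simp
  ultimately show ?thesis
    using mult_right_mono[of "bump_moment k \<phi> A" "\<bar>bump_moment k \<phi> A\<bar>"
      "norm (\<Sum>n\<in>?J. D n * of_real ((x - lam n) powr k) * exp (- of_real (lam n) * s))"]
    unfolding norm_mult norm_of_real by (meson norm_ge_zero order_trans)
qed

section \<open>From scales to gaps of the frequency\<close>

lemma frequency_separated:
  assumes lam: "frequency lam" and j: "1 \<le> j"
  shows "\<exists>d>0. \<forall>n\<ge>1. n \<noteq> j \<longrightarrow> d \<le> \<bar>lam n - lam j\<bar>"
proof -
  define d where "d = min (lam (Suc j) - lam j) (if j = 1 then 1 else lam j - lam (j - 1))"
  have "0 < d"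
    using frequency_less[OF lam j, of "Suc j"] frequency_less[OF lam, of "j - 1" j] j
    by (auto simp: d_def)
  moreover have "d \<le> \<bar>lam n - lam j\<bar>" if n: "1 \<le> n" "n \<noteq> j" for n
  proof (cases "n < j")
    case True
    then have "lam n \<le> lam (j - 1)" "j \<noteq> 1"
      using n by (auto intro: frequency_le[OF lam])
    then show ?thesis by (auto simp: d_def)
  next
    case False
    then have "lam (Suc j) \<le> lam n"
      using n j by (intro frequency_le[OF lam]) auto
    then show ?thesis by (auto simp: d_def)
  qed
  ultimately show ?thesis by blast
qed

lemma continuous_of_fourier:
  assumes cont: "continuous_on UNIV \<kappa>" and int: "integrable lborel (\<lambda>t. norm (\<kappa> t) * (1 + \<bar>t\<bar>) ^ M)"
    and \<phi>: "\<And>u. fourier \<kappa> u = complex_of_real (\<phi> u)"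
  shows "continuous_on UNIV \<phi>"
proof -
  have "integrable lborel \<kappa>"
    using borel_measurable_continuous_onI[OF cont] int
    by (rule integrable_weighted) (auto intro: one_le_power)
  from continuous_on_Re[OF continuous_fourier[OF this]] show ?thesis
    by (simp add: \<phi>)
qed

context half_plane_growth
begin

context
  fixes \<kappa> :: "real \<Rightarrow> complex" and \<phi> :: "real \<Rightarrow> real" and A :: real
    and lam :: "nat \<Rightarrow> real" and D :: "nat \<Rightarrow> complex"
  assumes cont: "continuous_on UNIV \<kappa>" and int: "integrable lborel (\<lambda>t. norm (\<kappa> t) * (1 + \<bar>t\<bar>) ^ M)"
    and \<phi>: "\<And>u. fourier \<kappa> u = complex_of_real (\<phi> u)" "\<And>u. A \<le> \<bar>u\<bar> \<Longrightarrow> \<phi> u = 0"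
    and \<phi>_nonneg: "\<And>u. 0 \<le> \<phi> u" and \<phi>0: "0 < \<phi> 0" and A: "0 < A"
    and lam: "frequency lam" and ext: "extends_riesz_limit lam D f"
begin

text \<open>A bump narrower than the distance of \<open>\<lambda>\<^sub>j\<close> to all other frequencies isolates the coefficient \<open>a\<^sub>j\<close>.\<close>
lemma coefficient_bound:
  assumes s: "0 < Re s" and j: "1 \<le> j" and r: "0 < r"
    and sep: "\<And>n. 1 \<le> n \<Longrightarrow> n \<noteq> j \<Longrightarrow> A * r \<le> \<bar>lam n - lam j\<bar>"
  shows "\<phi> 0 * norm (D j * exp (- of_real (lam j) * s))
    \<le> B * (1 + norm s) powr k * max 1 (1 / r) powr k * (LINT t|lborel. norm (\<kappa> t) * (1 + \<bar>t\<bar>) ^ M)"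
proof -
  let ?N = "{n. 1 \<le> n \<and> lam n \<le> lam j + A * r}"
  let ?t = "\<lambda>n. D n * of_real (\<phi> ((lam n - lam j) / r)) * exp (- of_real (lam n) * s)"
  have "sum ?t {j} = sum ?t ?N"
  proof (rule sum.mono_neutral_left)
    show "{j} \<subseteq> ?N" using j A r by simp
    show "\<forall>n\<in>?N - {j}. ?t n = 0"
    proof
      fix n assume "n \<in> ?N - {j}"
      then have "A \<le> \<bar>(lam n - lam j) / r\<bar>"
        using sep[of n] r by (simp add: abs_divide le_divide_eq)
      then show "?t n = 0" by (simp add: \<phi>(2))
    qed
  qed (rule finite_frequency_le[OF lam])
  moreover have "norm (sum ?t {j}) = \<phi> 0 * norm (D j * exp (- of_real (lam j) * s))"
    using \<phi>0 by (simp add: norm_mult)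
  ultimately show ?thesis
    using bump_sum_bound[OF cont int \<phi>(1) _ lam ext s r, of A "lam j"] \<phi>(2) by simp
qed

text \<open>
  The frequencies below \<open>x\<close> are handled by the superposition of bumps. A frequency equal to \<open>x\<close> contributes only for
  \<open>k = 0\<close>; then \<open>max(1, 1/r) powr k = 1\<close>, and \<open>coefficient_bound\<close> costs a constant however close the
  neighbouring frequencies are.
\<close>
lemma riesz_mean_bound:
  assumes s: "0 < Re s" and x: "0 < x"
    and I: "finite I" "\<And>i. i \<in> I \<Longrightarrow> 0 < a i" "\<And>i. i \<in> I \<Longrightarrow> a i \<le> b i" "\<And>i. i \<in> I \<Longrightarrow> b i \<le> x"
    and cover: "\<And>n. 1 \<le> n \<Longrightarrow> lam n < x \<Longrightarrow> \<exists>i\<in>I. a i \<le> (x - lam n) / (2*A+1) \<and> x - lam n \<le> b i"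
  shows "norm (riesz_mean lam k x D s)
    \<le> B * (LINT t|lborel. norm (\<kappa> t) * (1 + \<bar>t\<bar>) ^ M) * (max 1 (1 / x) powr k / bump_moment k \<phi> A + 1 / \<phi> 0)
       * (1 + norm s) powr k * ((\<Sum>i\<in>I. ln (b i) - ln (a i)) + 1)"
proof -
  let ?W = "LINT t|lborel. norm (\<kappa> t) * (1 + \<bar>t\<bar>) ^ M"
  let ?J = "{n. 1 \<le> n \<and> lam n < x}" and ?Z = "{n. 1 \<le> n \<and> lam n = x}"
  let ?c = "bump_moment k \<phi> A"
  let ?t = "\<lambda>n. D n * of_real (riesz_weight lam k x n) * exp (- of_real (lam n) * s)"
  let ?P = "\<Sum>n\<in>?J. D n * of_real ((x - lam n) powr k) * exp (- of_real (lam n) * s)"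
  let ?G = "\<Sum>i\<in>I. ln (b i) - ln (a i)"
  let ?s = "(1 + norm s) powr k"
  have c: "0 < ?c"
    by (rule bump_moment_pos[OF continuous_of_fourier[OF cont int \<phi>(1)] \<phi>_nonneg \<phi>0 A])
  have W: "0 \<le> ?W" by (intro Bochner_Integration.integral_nonneg) auto
  have G: "0 \<le> ?G"
  proof (intro sum_nonneg)
    fix i assume "i \<in> I"
    then have "ln (a i) \<le> ln (b i)"
      using I(2,3)[of i] by (intro ln_mono) auto
    then show "0 \<le> ln (b i) - ln (a i)" by simp
  qed
  have fin: "finite {n. 1 \<le> n \<and> lam n \<le> x}"
    by (rule finite_frequency_le[OF lam])
  have union: "{n. 1 \<le> n \<and> lam n \<le> x} = ?J \<union> ?Z" by (auto simp: le_less)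
  have "sum ?t (?J \<union> ?Z) = sum ?t ?J + sum ?t ?Z"
    using fin unfolding union by (intro sum.union_disjoint) auto
  then have split: "riesz_mean lam k x D s = sum ?t ?J + sum ?t ?Z"
    unfolding riesz_mean_def union .
  have "sum ?t ?J = ?P / of_real (x powr k)"
    unfolding sum_divide_distrib
  proof (intro sum.cong refl)
    fix n assume n: "n \<in> ?J"
    have "riesz_weight lam k x n = (x - lam n) powr k / x powr k"
    proof (cases "k = 0")
      case False
      have "1 - lam n / x = (x - lam n) / x" using x by (simp add: field_simps)
      then show ?thesis using False n x by (simp add: riesz_weight_def powr_divide)
    qed (use n x in \<open>simp add: riesz_weight_def\<close>)
    then show "?t n = D n * of_real ((x - lam n) powr k) * exp (- of_real (lam n) * s) / of_real (x powr k)"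
      by simp
  qed
  then have "norm (sum ?t ?J) = norm ?P / x powr k"
    by (simp add: norm_divide)
  also have "\<dots> \<le> B * ?W * ?s * (max 1 (1 / x) powr k / ?c) * ?G"
  proof -
    have "?c * norm ?P \<le> B * ?s * max x 1 powr k * ?W * ?G"
      by (rule superposition_bound[OF cont int \<phi> continuous_of_fourier[OF cont int \<phi>(1)] A lam ext s I cover])
    moreover have "max x 1 powr k = x powr k * max 1 (1 / x) powr k"
    proof -
      have "max x 1 = x * max 1 (1 / x)"
        using x by (auto simp: max_def field_simps)
      then show ?thesis using x by (simp add: powr_mult)
    qed
    ultimately have "norm ?P \<le> (B * ?s * (x powr k * max 1 (1 / x) powr k) * ?W * ?G) / ?c"
      using c by (simp add: pos_le_divide_eq mult.commute)
    then have "norm ?P / x powr k \<le> (B * ?s * (x powr k * max 1 (1 / x) powr k) * ?W * ?G) / ?c / x powr k"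
      by (rule divide_right_mono) simp
    also have "\<dots> = B * ?W * ?s * (max 1 (1 / x) powr k / ?c) * ?G"
      using x by simp
    finally show ?thesis .
  qed
  finally have 1: "norm (sum ?t ?J) \<le> B * ?W * ?s * (max 1 (1 / x) powr k / ?c) * ?G" .
  have 2: "norm (sum ?t ?Z) \<le> B * ?W * ?s * (1 / \<phi> 0)"
  proof (cases "k = 0 \<and> ?Z \<noteq> {}")
    case True
    then obtain j where j: "1 \<le> j" "lam j = x" by blast
    have "?Z = {j}"
    proof -
      have "n = j" if "1 \<le> n" "lam n = x" for n
        using frequency_less[OF lam, of n j] frequency_less[OF lam, of j n] that j by (metis less_irrefl nat_neq_iff)
      then show ?thesis using j by blast
    qed
    obtain d where d: "0 < d" "\<And>n. 1 \<le> n \<Longrightarrow> n \<noteq> j \<Longrightarrow> d \<le> \<bar>lam n - lam j\<bar>"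
      using frequency_separated[OF lam j(1)] by blast
    have "\<phi> 0 * norm (D j * exp (- of_real (lam j) * s)) \<le> B * ?s * max 1 (1 / (d / A)) powr k * ?W"
      using d A by (intro coefficient_bound[OF s j(1)]) auto
    moreover have "max 1 (1 / (d / A)) powr k = 1"
      using True by simp
    ultimately have "norm (D j * exp (- of_real (lam j) * s)) \<le> (B * ?s * ?W) / \<phi> 0"
      using \<phi>0 by (simp add: pos_le_divide_eq mult.commute)
    moreover have "sum ?t ?Z = D j * exp (- of_real (lam j) * s)"
      unfolding \<open>?Z = {j}\<close> using True by (simp add: riesz_weight_def)
    ultimately show ?thesis by (simp add: mult_ac)
  next
    case False
    then have "?t n = 0" if "n \<in> ?Z" for n
      using that x by (auto simp: riesz_weight_def)
    then have "sum ?t ?Z = 0" by (intro sum.neutral) auto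
    then show ?thesis using B_nonneg W \<phi>0 by simp
  qed
  have "norm (riesz_mean lam k x D s) \<le> B * ?W * ?s * (max 1 (1 / x) powr k / ?c) * ?G + B * ?W * ?s * (1 / \<phi> 0)"
    unfolding split using norm_triangle_ineq[of "sum ?t ?J" "sum ?t ?Z"] 1 2 by linarith
  also have "\<dots> \<le> B * ?W * ?s * (max 1 (1 / x) powr k / ?c) * (?G + 1) + B * ?W * ?s * (1 / \<phi> 0) * (?G + 1)"
  proof (intro add_mono)
    show "B * ?W * ?s * (max 1 (1 / x) powr k / ?c) * ?G \<le> B * ?W * ?s * (max 1 (1 / x) powr k / ?c) * (?G + 1)"
      using B_nonneg W c by (intro mult_left_mono) auto
    have "B * ?W * ?s * (1 / \<phi> 0) * 1 \<le> B * ?W * ?s * (1 / \<phi> 0) * (?G + 1)"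
      using B_nonneg W \<phi>0 G by (intro mult_left_mono) auto
    then show "B * ?W * ?s * (1 / \<phi> 0) \<le> B * ?W * ?s * (1 / \<phi> 0) * (?G + 1)" by simp
  qed
  also have "\<dots> = B * ?W * (max 1 (1 / x) powr k / ?c + 1 / \<phi> 0) * ?s * (?G + 1)"
    by (simp only: distrib_left distrib_right mult_ac)
  finally show ?thesis .
qed

end

end

text \<open>
  A Dirichlet polynomial is summable of every order at every point, to its own value. Hence its limit function on the
  half-plane is the polynomial itself, whichever order the choice in \<open>limit_fun\<close> refers to.
\<close>
lemma riesz_mean_polynomial_tendsto:
  assumes lam: "frequency lam" and l: "0 \<le> l"
  shows "((\<lambda>y. riesz_mean lam l y (riesz_op lam k x D) s) \<longlongrightarrow> riesz_mean lam k x D s) at_top"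
proof (rule Lim_transform_eventually)
  let ?P = "riesz_op lam k x D"
  let ?N = "{n. 1 \<le> n \<and> lam n \<le> x}"
  have "((\<lambda>y. \<Sum>n\<in>?N. ?P n * of_real (riesz_weight lam l y n) * exp (- of_real (lam n) * s))
    \<longlongrightarrow> (\<Sum>n\<in>?N. ?P n * of_real 1 * exp (- of_real (lam n) * s))) at_top"
    by (intro tendsto_intros riesz_weight_tendsto_1[OF l])
  also have "(\<Sum>n\<in>?N. ?P n * of_real 1 * exp (- of_real (lam n) * s)) = riesz_mean lam k x D s"
    unfolding riesz_mean_def by (intro sum.cong refl) (simp add: riesz_op_def)
  finally show "((\<lambda>y. \<Sum>n\<in>?N. ?P n * of_real (riesz_weight lam l y n) * exp (- of_real (lam n) * s))
    \<longlongrightarrow> riesz_mean lam k x D s) at_top" .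
  show "\<forall>\<^sub>F y in at_top. (\<Sum>n\<in>?N. ?P n * of_real (riesz_weight lam l y n) * exp (- of_real (lam n) * s))
    = riesz_mean lam l y ?P s"
    using eventually_ge_at_top[of x]
  proof eventually_elim
    case (elim y)
    show ?case
      unfolding riesz_mean_def[of lam l y]
      by (rule sum.mono_neutral_left)
        (use elim finite_frequency_le[OF lam] in \<open>auto simp: riesz_op_def\<close>)
  qed
qed

lemma limit_fun_polynomial:
  assumes lam: "frequency lam" and s: "0 < Re s"
  shows "limit_fun lam (riesz_op lam k x D) s = riesz_mean lam k x D s"
proof -
  let ?P = "riesz_op lam k x D"
  have abscissa: "riesz_abscissa lam l ?P = -\<infinity>" if l: "0 \<le> l" for l
  proof -
    have "riesz_abscissa lam l ?P \<le> ereal \<sigma>" for \<sigma>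
    proof -
      have "riesz_summable lam l ?P (of_real \<sigma>)"
        unfolding riesz_summable_def using riesz_mean_polynomial_tendsto[OF lam l] by (rule exI)
      then show ?thesis
        unfolding riesz_abscissa_def by (intro INF_lower) simp
    qed
    then show ?thesis
      using ereal_bot by blast
  qed
  have "extends_riesz_limit lam ?P (riesz_mean lam k x D)"
    unfolding extends_riesz_limit_def
  proof (intro conjI exI[of _ 0] allI impI)
    show "riesz_mean lam k x D holomorphic_on {s. 0 < Re s}"
      unfolding riesz_mean_def by (intro holomorphic_intros)
    show "riesz_abscissa lam 0 ?P < \<infinity>" by (simp add: abscissa)
  qed (use riesz_mean_polynomial_tendsto[OF lam] in auto)
  then have "extends_riesz_limit lam ?P (limit_fun lam ?P)"
    unfolding limit_fun_def by (rule someI[of "extends_riesz_limit lam ?P"])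
  then obtain l where l: "0 \<le> l" and
    lim: "\<forall>s. 0 < Re s \<and> riesz_abscissa lam l ?P < ereal (Re s) \<longrightarrow>
           ((\<lambda>x. riesz_mean lam l x ?P s) \<longlongrightarrow> limit_fun lam ?P s) at_top"
    unfolding extends_riesz_limit_def by blast
  have "((\<lambda>y. riesz_mean lam l y ?P s) \<longlongrightarrow> limit_fun lam ?P s) at_top"
    using lim s abscissa[OF l] by simp
  from tendsto_unique[OF trivial_limit_at_top_linorder this riesz_mean_polynomial_tendsto[OF lam l]]
  show ?thesis .
qed

lemma ext_space_unit_ball:
  assumes "D \<in> ext_space lam k" "ext_norm lam k D \<le> 1"
  shows "extends_riesz_limit lam D (limit_fun lam D)"
    and "0 < Re s \<Longrightarrow> norm (limit_fun lam D s) \<le> 1 * (1 + norm s) powr k"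
proof -
  show "extends_riesz_limit lam D (limit_fun lam D)"
    using assms(1) someI_ex[of "extends_riesz_limit lam D"] unfolding ext_space_def limit_fun_def by simp
  assume s: "0 < Re s"
  then have "ereal (cmod (limit_fun lam D s) / (1 + cmod s) powr k) \<le> ext_norm lam k D"
    unfolding ext_norm_def by (intro SUP_upper) auto
  also note assms(2)
  finally have "cmod (limit_fun lam D s) / (1 + cmod s) powr k \<le> 1" by simp
  moreover have "0 < 1 + cmod s" by (simp add: add_pos_nonneg)
  ultimately show "norm (limit_fun lam D s) \<le> 1 * (1 + norm s) powr k"
    by (simp add: divide_le_eq)
qed

lemma ext_op_norm_le:
  assumes lam: "frequency lam"
    and bound: "\<And>D s. D \<in> ext_space lam k \<Longrightarrow> ext_norm lam k D \<le> 1 \<Longrightarrow> 0 < Re s \<Longrightarrow>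
      norm (riesz_mean lam k x D s) \<le> C * (1 + norm s) powr k"
  shows "ext_op_norm lam k (riesz_op lam k x) \<le> ereal C"
  unfolding ext_op_norm_def
proof (rule SUP_least)
  fix D assume D: "D \<in> {D \<in> ext_space lam k. ext_norm lam k D \<le> 1}"
  show "ext_norm lam k (riesz_op lam k x D) \<le> ereal C"
    unfolding ext_norm_def
  proof (rule SUP_least)
    fix s :: complex assume "s \<in> {s. 0 < Re s}"
    then have s: "0 < Re s" by simp
    have "0 < 1 + cmod s" by (simp add: add_pos_nonneg)
    then show "ereal (cmod (limit_fun lam (riesz_op lam k x D) s) / (1 + cmod s) powr k) \<le> ereal C"
      using bound[of D s] D s unfolding limit_fun_polynomial[OF lam s] by (simp add: divide_le_eq)
  qed
qed

lemma m_tilde_greatest: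
  assumes m: "\<And>j. 1 \<le> j \<Longrightarrow> j < m j" and ne: "{j. 1 \<le> j \<and> m j \<le> n} \<noteq> {}"
  shows "1 \<le> m_tilde m n" "m (m_tilde m n) \<le> n" "\<And>j. 1 \<le> j \<Longrightarrow> m j \<le> n \<Longrightarrow> j \<le> m_tilde m n"
proof -
  let ?A = "{j. 1 \<le> j \<and> m j \<le> n}"
  have "?A \<subseteq> {..n}"
    using m by (auto dest!: order.strict_trans2 intro: less_imp_le)
  then have fin: "finite ?A" by (rule finite_subset) simp
  have eq: "m_tilde m n = Max ?A"
    unfolding m_tilde_def using fin ne by (rule cSup_eq_Max)
  show "1 \<le> m_tilde m n" "m (m_tilde m n) \<le> n"
    using Max_in[OF fin ne] by (auto simp: eq)
  show "j \<le> m_tilde m n" if "1 \<le> j" "m j \<le> n" for j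
    unfolding eq using that by (intro Max_ge[OF fin]) simp
qed

lemma log_gap_nonneg:
  assumes lam: "frequency lam" and l: "1 \<le> l" "l < i"
  shows "0 \<le> ln (lam i / (lam i - lam l))"
proof -
  have "0 \<le> lam l" "lam l < lam i"
    using frequency_nonneg[OF lam l(1)] frequency_less[OF lam l] by auto
  then show ?thesis by (intro ln_ge_zero) (simp add: le_divide_eq)
qed

text \<open>
  From \<open>ln y \<ge> 1 - 1/y\<close> the logarithm is at least \<open>\<lambda>\<^sub>l / \<lambda>\<^sub>i\<close>, which is at least \<open>\<lambda>\<^sub>l / (\<lambda>\<^sub>l + 2)\<close>. The index \<open>l \<ge> 2\<close>
  keeps \<open>\<lambda>\<^sub>l\<close> away from \<open>0\<close>, as \<open>\<lambda>\<^sub>1 = 0\<close> is possible.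
\<close>
lemma log_gap_lower_bound:
  assumes lam: "frequency lam" and l: "2 \<le> l" "l < i" and gap: "lam i - lam l \<le> 2"
  shows "lam 2 / (lam 2 + 2) \<le> ln (lam i / (lam i - lam l))"
proof -
  have 2: "0 < lam 2" "lam 2 \<le> lam l" "lam l < lam i"
    using frequency_less[OF lam, of 1 2] frequency_nonneg[OF lam, of 1] frequency_le[OF lam, of 2 l]
      frequency_less[OF lam, of l i] l by auto
  have "lam 2 / (lam 2 + 2) \<le> lam l / (lam l + 2)"
    using 2 by (simp add: divide_simps) (simp add: algebra_simps)
  also have "\<dots> \<le> lam l / lam i"
    using 2 gap by (intro divide_left_mono) auto
  also have "\<dots> = 1 - (lam i - lam l) / lam i"
    using 2 by (simp add: diff_divide_distrib)
  also have "\<dots> \<le> - ln ((lam i - lam l) / lam i)"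
    using ln_le_minus_one[of "(lam i - lam l) / lam i"] 2 by simp
  also have "\<dots> = ln (lam i / (lam i - lam l))"
    using 2 by (simp add: ln_div)
  finally show ?thesis .
qed

text \<open>
  The summand \<open>l = l0\<close> will pay for all scales down to \<open>\<lambda>(m(l0)) - \<lambda>(l0)\<close>, and each later summand for the scales
  of one further frequency.
\<close>
lemma gap_sum_lower_bound:
  fixes w :: "nat \<Rightarrow> nat \<Rightarrow> real"
  assumes lam: "frequency lam"
    and m: "\<And>l. 1 \<le> l \<Longrightarrow> l < m l" "\<And>l. 1 \<le> l \<Longrightarrow> lam (m l) - lam l \<le> 2"
    and l0: "1 \<le> l0" "l0 \<le> n" and w: "\<And>l j. 0 \<le> w l j"
  shows "ln (lam (m l0) / (lam (m l0) - lam l0)) + real (n - l0) * (lam 2 / (lam 2 + 2))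
    \<le> (\<Sum>l = l0..n. ln (lam (m l) / (lam (m l) - lam l)) + (\<Sum>j = l + 1..m l - 1. w l j))"
proof -
  let ?g = "\<lambda>l. ln (lam (m l) / (lam (m l) - lam l))"
  have "real (n - l0) * (lam 2 / (lam 2 + 2)) = (\<Sum>l = Suc l0..n. lam 2 / (lam 2 + 2))"
    by simp
  also have "\<dots> \<le> (\<Sum>l = Suc l0..n. ?g l)"
    using l0 m by (intro sum_mono log_gap_lower_bound[OF lam]) auto
  finally have "?g l0 + real (n - l0) * (lam 2 / (lam 2 + 2)) \<le> (\<Sum>l = l0..n. ?g l)"
    using l0(2) by (simp add: sum.atLeast_Suc_atMost)
  also have "\<dots> \<le> (\<Sum>l = l0..n. ?g l + (\<Sum>j = l + 1..m l - 1. w l j))"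
    using w by (intro sum_mono) (simp add: sum_nonneg)
  finally show ?thesis .
qed

theorem proposition6p9:
  fixes lam :: "nat \<Rightarrow> real" and k :: real and m :: "nat \<Rightarrow> nat"
  assumes "frequency lam"
    and "0 \<le> k"
    and "\<And>n. 1 \<le> n \<Longrightarrow> n < m n"
    and "\<And>n. 1 \<le> n \<Longrightarrow> lam (m n) - lam n \<le> 2"
  shows "\<exists>C::real. 0 < C \<and>
    (\<forall>n\<ge>1. {j. 1 \<le> j \<and> m j \<le> n} \<noteq> {} \<longrightarrow>
      (SUP x \<in> {lam n..lam (n + 1)}. ext_op_norm lam k (riesz_op lam k x))
        \<le> ereal (C * (\<Sum>l = m_tilde m n..n.
            ln (lam (m l) / (lam (m l) - lam l)) +
            (\<Sum>j = l + 1..m l - 1. ((lam j - lam l) / eps lam j) powr k))))"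
proof -
  note lam = assms(1) and m = assms(3,4)
  define M where "M = nat \<lceil>k\<rceil>"
  have kM: "k \<le> real M" unfolding M_def by linarith
  obtain \<kappa> \<phi> A where cont: "continuous_on UNIV \<kappa>" and int: "integrable lborel (\<lambda>t. norm (\<kappa> t) * (1 + \<bar>t\<bar>) ^ M)"
    and \<phi>: "\<And>u. fourier \<kappa> u = complex_of_real (\<phi> u)" "\<And>u. 0 \<le> \<phi> u" "0 < \<phi> 0"
    and A: "0 < A" and supp: "\<And>u. A \<le> \<bar>u\<bar> \<Longrightarrow> \<phi> u = 0"
    using exists_band_limited_bump[of M] by blast
  \<comment> \<open>\<open>K\<close> bounds the cost of one unit of logarithmic length of scales, since \<open>x \<ge> \<lambda>\<^sub>2\<close>, and \<open>q\<close> bounds each later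
    logarithm on the right-hand side from below; \<open>C\<close> converts constants and counts into such logarithms.\<close>
  define S where "S = 2 * A + 1"
  define q where "q = lam 2 / (lam 2 + 2)"
  define K where "K = (LINT t|lborel. norm (\<kappa> t) * (1 + \<bar>t\<bar>) ^ M) * (max 1 (1 / lam 2) powr k / bump_moment k \<phi> A + 1 / \<phi> 0)"
  define c0 where "c0 = ln S + ln (1 + 2 / lam 2) + 1"
  define C where "C = K * (c0 / q + 1 + ln S / q) + 1"
  have l2: "0 < lam 2"
    using frequency_less[OF lam, of 1 2] frequency_nonneg[OF lam, of 1] by simp
  have S: "1 < S" and lnS: "0 < ln S" using A by (auto simp: S_def)
  have q: "0 < q" using l2 by (simp add: q_def)
  have c0: "0 < c0"
    unfolding c0_def using lnS l2 by (intro add_pos_pos add_pos_nonneg) auto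
  have moment: "0 < bump_moment k \<phi> A"
    by (rule bump_moment_pos[OF continuous_of_fourier[OF cont int \<phi>(1)] \<phi>(2,3) A])
  have K: "0 \<le> K"
    unfolding K_def using moment \<phi>(3) by (intro mult_nonneg_nonneg add_nonneg_nonneg Bochner_Integration.integral_nonneg) auto
  have C: "0 < C"
    unfolding C_def using K c0 q lnS by (intro add_nonneg_pos mult_nonneg_nonneg) auto
  have "(SUP x \<in> {lam n..lam (n + 1)}. ext_op_norm lam k (riesz_op lam k x))
        \<le> ereal (C * (\<Sum>l = m_tilde m n..n.
            ln (lam (m l) / (lam (m l) - lam l)) +
            (\<Sum>j = l + 1..m l - 1. ((lam j - lam l) / eps lam j) powr k)))"
    if n: "1 \<le> n" and ne: "{j. 1 \<le> j \<and> m j \<le> n} \<noteq> {}" for n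
  proof (rule SUP_least, rule ext_op_norm_le[OF lam])
    fix x D and s :: complex
    assume x: "x \<in> {lam n..lam (n + 1)}" and D: "D \<in> ext_space lam k" "ext_norm lam k D \<le> 1" and s: "0 < Re s"
    let ?T = "\<Sum>l = m_tilde m n..n. ln (lam (m l) / (lam (m l) - lam l)) +
            (\<Sum>j = l + 1..m l - 1. ((lam j - lam l) / eps lam j) powr k)"
    define p where "p = m_tilde m n"
    have p: "1 \<le> p" "m p \<le> n" and greatest: "\<And>j. 1 \<le> j \<Longrightarrow> m j \<le> n \<Longrightarrow> j \<le> p"
      using m_tilde_greatest[of m n, OF m(1) ne] by (auto simp: p_def)
    define \<delta> where "\<delta> = lam (m p) - lam p"
    have \<delta>: "0 < \<delta>"
      using frequency_less[OF lam p(1) m(1)[OF p(1)]] by (simp add: \<delta>_def)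
    have pn: "p < n" "2 \<le> n" "2 \<le> m p"
      using m(1)[OF p(1)] p by auto
    have lam_mp: "lam 2 \<le> lam (m p)" "lam (m p) \<le> x" "lam 2 \<le> x"
      using frequency_le[OF lam, of 2 "m p"] frequency_le[OF lam, of "m p" n] pn p x by auto
    have x0: "0 < x" using lam_mp l2 by linarith
    have \<delta>x: "\<delta> \<le> x" "\<delta> \<le> x - lam p"
      using lam_mp frequency_nonneg[OF lam p(1)] by (auto simp: \<delta>_def)
    have x_le: "x \<le> (1 + 2 / lam 2) * lam (m p)"
    proof -
      \<comment> \<open>By maximality of \<open>p\<close>, \<open>m (p + 1) > n\<close>, so \<open>x\<close> exceeds \<open>\<lambda>\<^sub>p\<^sub>+\<^sub>1 \<le> \<lambda>(m(p))\<close> by at most \<open>2\<close>.\<close>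
      have "\<not> m (p + 1) \<le> n"
        using greatest[of "p + 1"] by auto
      then have "lam (n + 1) \<le> lam (m (p + 1))"
        by (intro frequency_le[OF lam]) auto
      moreover have "lam (p + 1) \<le> lam (m p)"
        using m(1)[OF p(1)] by (intro frequency_le[OF lam]) auto
      ultimately have "x \<le> lam (m p) + 2"
        using m(2)[of "p + 1"] x by simp
      also have "\<dots> \<le> lam (m p) + (2 / lam 2) * lam (m p)"
        using lam_mp l2 by (simp add: divide_simps algebra_simps)
      finally show ?thesis by (simp add: distrib_right)
    qed
    \<comment> \<open>Index \<open>p\<close> stands for the scales of all frequencies up to \<open>\<lambda>\<^sub>p\<close>, whose distances to \<open>x\<close> lie in \<open>[\<delta>, x]\<close>;
      every later frequency below \<open>x\<close> has an interval of its own.\<close>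
    define I where "I = insert p {j \<in> {p<..n}. lam j < x}"
    define a where "a i = (if i = p then \<delta> / S else (x - lam i) / S)" for i
    define b where "b i = (if i = p then x else x - lam i)" for i
    have growth: "half_plane_growth (limit_fun lam D) 1 k M"
      using ext_space_unit_ball[OF D] assms(2) kM
      by unfold_locales (auto simp: extends_riesz_limit_def)
    have "norm (riesz_mean lam k x D s)
      \<le> 1 * (LINT t|lborel. norm (\<kappa> t) * (1 + \<bar>t\<bar>) ^ M) * (max 1 (1 / x) powr k / bump_moment k \<phi> A + 1 / \<phi> 0)
         * (1 + norm s) powr k * ((\<Sum>i\<in>I. ln (b i) - ln (a i)) + 1)"
    proof (rule half_plane_growth.riesz_mean_bound[OF growth cont int \<phi>(1) supp \<phi>(2,3) A lam ext_space_unit_ball(1)[OF D] s x0])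
      show "finite I" by (simp add: I_def)
      fix i assume i: "i \<in> I"
      have shrink: "y / S \<le> y" if "0 \<le> y" for y
        using divide_left_mono[of 1 S y] that S by simp
      have "0 < a i \<and> a i \<le> b i \<and> b i \<le> x"
      proof (cases "i = p")
        case True
        have "0 < \<delta> / S" using \<delta> S by simp
        then show ?thesis
          using True shrink[of \<delta>] \<delta> \<delta>x(1) by (simp add: a_def b_def)
      next
        case False
        then have i': "1 \<le> i" "lam i < x" using i p(1) by (auto simp: I_def)
        then have "0 < (x - lam i) / S" using S by simp
        then show ?thesis
          using False shrink[of "x - lam i"] i' frequency_nonneg[OF lam i'(1)] by (simp add: a_def b_def)
      qed
      then show "0 < a i" "a i \<le> b i" "b i \<le> x" by blast+
    next
      show "\<exists>i\<in>I. a i \<le> (x - lam j) / (2 * A + 1) \<and> x - lam j \<le> b i" if j: "1 \<le> j" "lam j < x" for j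
      proof (cases "j \<le> p")
        case True
        then have "lam j \<le> lam p" "0 \<le> lam j"
          using j by (auto intro: frequency_le[OF lam] frequency_nonneg[OF lam])
        then have "\<delta> / S \<le> (x - lam j) / S" "x - lam j \<le> x"
          using \<delta>x S by (auto intro!: divide_right_mono)
        then show ?thesis
          by (intro bexI[of _ p]) (auto simp: I_def a_def b_def S_def)
      next
        case False
        have "\<not> n < j"
        proof
          assume "n < j"
          then have "lam (n + 1) \<le> lam j" by (intro frequency_le[OF lam]) auto
          then show False using j x by simp
        qed
        then show ?thesis
          using False j by (intro bexI[of _ j]) (auto simp: I_def a_def b_def S_def)
      qed
    qed
    also have "\<dots> \<le> K * (1 + norm s) powr k * ((ln x - ln \<delta> + ln S + real (n - p) * ln S) + 1)"
    proof -
      have "(\<Sum>i\<in>I. ln (b i) - ln (a i)) = (ln (b p) - ln (a p)) + (\<Sum>i \<in> {j \<in> {p<..n}. lam j < x}. ln (b i) - ln (a i))"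
        unfolding I_def by (intro sum.insert) auto
      also have "ln (b p) - ln (a p) = ln x - ln \<delta> + ln S"
        using \<delta> S by (simp add: a_def b_def ln_div)
      also have "(\<Sum>i \<in> {j \<in> {p<..n}. lam j < x}. ln (b i) - ln (a i)) = (\<Sum>i \<in> {j \<in> {p<..n}. lam j < x}. ln S)"
        using S by (intro sum.cong refl) (auto simp: a_def b_def ln_div)
      also have "\<dots> \<le> (\<Sum>i \<in> {p<..n}. ln S)"
        using lnS by (intro sum_mono2) auto
      also have "\<dots> = real (n - p) * ln S" by simp
      finally have sum: "(\<Sum>i\<in>I. ln (b i) - ln (a i)) \<le> ln x - ln \<delta> + ln S + real (n - p) * ln S"
        by simp
      have K_le: "(LINT t|lborel. norm (\<kappa> t) * (1 + \<bar>t\<bar>) ^ M) * (max 1 (1 / x) powr k / bump_moment k \<phi> A + 1 / \<phi> 0) \<le> K"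
        unfolding K_def using moment lam_mp l2 assms(2)
        by (intro mult_left_mono add_right_mono divide_right_mono powr_mono2 max.mono divide_left_mono
            Bochner_Integration.integral_nonneg) auto
      have "ln \<delta> \<le> ln x" using \<delta> \<delta>x by (intro ln_mono) auto
      then have Z: "0 \<le> ln x - ln \<delta> + ln S + real (n - p) * ln S + 1"
        using lnS by simp
      have K0: "0 \<le> (LINT t|lborel. norm (\<kappa> t) * (1 + \<bar>t\<bar>) ^ M) * (max 1 (1 / x) powr k / bump_moment k \<phi> A + 1 / \<phi> 0)"
        using moment \<phi>(3) by (intro mult_nonneg_nonneg add_nonneg_nonneg Bochner_Integration.integral_nonneg) auto
      have "u * v * y \<le> u' * v * z" if "0 \<le> u" "u \<le> u'" "0 \<le> v" "y \<le> z" "0 \<le> z" for u u' v y z :: real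
      proof -
        have "u * v * y \<le> u * v * z"
          using that by (intro mult_left_mono) auto
        also have "\<dots> \<le> u' * v * z"
          using that by (intro mult_right_mono) auto
        finally show ?thesis .
      qed
      from this[OF K0 K_le _ _ Z] show ?thesis
        unfolding mult_1 using sum by simp
    qed
    also have "\<dots> \<le> C * ?T * (1 + norm s) powr k"
    proof -
      let ?L = "ln (lam (m p) / \<delta>)"
      have T: "?L + real (n - p) * q \<le> ?T"
        unfolding q_def \<delta>_def using gap_sum_lower_bound[OF lam m p(1), of n] pn
        by (simp add: p_def[symmetric])
      have L: "0 \<le> ?L"
        using log_gap_nonneg[OF lam p(1) m(1)[OF p(1)]] by (simp add: \<delta>_def)
      have np: "1 \<le> real (n - p)" using pn by simp
      have "q * 1 \<le> q * real (n - p)" using q np by (intro mult_left_mono) auto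
      then have qT: "q \<le> ?T" using T L by (simp add: mult.commute)
      have T0: "0 \<le> ?T" using qT q by simp
      have "ln x \<le> ln (1 + 2 / lam 2) + ln (lam (m p))"
      proof -
        have "ln x \<le> ln ((1 + 2 / lam 2) * lam (m p))"
          using x_le x0 by (intro ln_mono) auto
        also have "\<dots> = ln (1 + 2 / lam 2) + ln (lam (m p))"
          using lam_mp l2 by (intro ln_mult_pos add_pos_pos) auto
        finally show ?thesis .
      qed
      moreover have "?L = ln (lam (m p)) - ln \<delta>"
        using lam_mp l2 \<delta> by (simp add: ln_div)
      ultimately have "(ln x - ln \<delta> + ln S + real (n - p) * ln S) + 1 \<le> c0 + ?L + real (n - p) * ln S"
        by (simp add: c0_def)
      also have "\<dots> \<le> c0 / q * ?T + ?T + ln S / q * ?T"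
      proof (intro add_mono)
        show "c0 \<le> c0 / q * ?T"
          using mult_left_mono[OF qT, of "c0 / q"] c0 q by simp
        have "0 \<le> real (n - p) * q" using q by simp
        then show "?L \<le> ?T" using T by linarith
        have "real (n - p) * q \<le> ?T" using T L by linarith
        from mult_left_mono[OF this, of "ln S / q"] show "real (n - p) * ln S \<le> ln S / q * ?T"
          using lnS q by (simp add: mult.commute)
      qed
      also have "\<dots> = (c0 / q + 1 + ln S / q) * ?T"
        by (simp only: distrib_right mult_1)
      finally have "K * ((ln x - ln \<delta> + ln S + real (n - p) * ln S) + 1) \<le> K * ((c0 / q + 1 + ln S / q) * ?T)"
        using K by (rule mult_left_mono)
      also have "\<dots> \<le> C * ?T"
        using T0 unfolding C_def distrib_right[of _ 1] mult.assoc by simp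
      finally have "K * ((ln x - ln \<delta> + ln S + real (n - p) * ln S) + 1) * (1 + norm s) powr k \<le> C * ?T * (1 + norm s) powr k"
        by (rule mult_right_mono) simp
      then show ?thesis by (simp only: mult_ac)
    qed
    finally show "norm (riesz_mean lam k x D s) \<le> C * ?T * (1 + norm s) powr k" .
  qed
  then show ?thesis using C by blast
qed

end
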